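(* Let $n\ge2$ and $m=\lfloor n/2\rfloor$. (1) Let $W_1,W_2$ be two real $n$-dimensional subspaces of $\mathbb{C}^n$. There exists $g\in SU(n)$ with $gW_1=W_2$ if and only if $W_1$ and $W_2$ have the same Kähler angles and the same $\Theta$-invariant. (2) If $W\in\mathrm{Gr}_n(\mathbb{C}^n)$ has Kähler angles $\theta_1,\dots,\theta_m$ and $\Theta:=\Theta(W)$, then $$|\Theta|=\prod_{j=1}^m\sin(\theta_j).$$ Conversely, given $0\le\theta_1\le\dots\le\theta_m\le\pi/2$ and $\Theta$ (an element of $\mathbb{C}$ if $n$ is even and $\theta_m<\pi/2$, and of $\mathbb{C}/\{\pm1\}$ otherwise) satisfying this equation, there exists $W\in\mathrm{Gr}_n(\mathbb{C}^n)$ with $\theta_j(W)=\theta_j$ for all $j$ and $\Theta(W)=\Theta$. (3) For all $W\in\mathrm{Gr}_n(\mathbb{C}^n)$, with $W^\perp$ the Euclidean orthogonal complement, $$\Theta(W^\perp)=\Theta(W).$$ (4) If $k\ne n$, then the orbits of $U(n)$ and $SU(n)$ on $\mathrm{Gr}_k(\mathbb{C}^n)$ are the same.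
   Context: $\mathbb{C}^n=\mathbb{R}^{2n}$ carries its standard Hermitian and Euclidean structures, and $\mathrm{Gr}_k(\mathbb{C}^n)$ is the Grassmannian of real $k$-dimensional linear subspaces of $\mathbb{C}^n$. Kähler angles. Let $J$ be multiplication by $\sqrt{-1}$ and $W\in\mathrm{Gr}_n(\mathbb{C}^n)$, with orthogonal projection $\pi_W$ onto $W$. The skew-symmetric endomorphism $\pi_W\circ J|_W$ of $W$ has eigenvalues $\pm i\cos\theta_1,\dots,\pm i\cos\theta_m$ (together with $0$ if $n$ is odd), $m=\lfloor n/2\rfloor$, for unique $0\le\theta_1\le\dots\le\theta_m\le\pi/2$; the $\theta_j=\theta_j(W)$ are the Kähler angles of $W$. $\Theta$-invariant. Choose a Euclidean orthonormal basis $w_1,\dots,w_n$ of $W$. If the restriction to $W$ of the standard symplectic (Kähler) form of $\mathbb{C}^n$ is nondegenerate (equivalently $n$ is even and all Kähler angles are $<\pi/2$), the basis is required to be positively oriented for the orientation of $W$ defined by the $m$-th power of the symplectic form. Then $\Theta(W):=\det(w_1,\dots,w_n)$ (complex determinant of the $n\times n$ matrix with columns $w_j$), which is a well-defined element of $\mathbb{C}$ in the nondegenerate case and a well-defined element of $\mathbb{C}/\{\pm1\}$ otherwise.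
   Formalization: Part (3) as printed fails for odd n (W = R^n has Θ = ±1, its complement iR^n has Θ = ±i); what is proved is Θ(W^⊥) = Θ(W) for even n and Θ(W^⊥) = i·Θ(W) in C/{±1} for odd n. *)

theory Defs
  imports
    "HOL-Analysis.Analysis"
    "HOL-Computational_Algebra.Polynomial"
begin

(* The type complex^'n has its Euclidean structure from HOL-Analysis: the inner product is
   the real part of the standard Hermitian one, and the unqualified subspace, span, dim
   and orthogonal complement are those over the reals. *)

definition Gr :: "nat \<Rightarrow> (complex^'n) set set" where
  "Gr k = {W. subspace W \<and> dim W = k}"

definition Jmul :: "complex^'n \<Rightarrow> complex^'n" where
  "Jmul x = \<i> *s x"

(* The standard symplectic form, sum of dx_j \<and> dy_j, so that each pair (x, Jmul x)
   with x nonzero is positive. *)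
definition kahler_form :: "complex^'n \<Rightarrow> complex^'n \<Rightarrow> real" where
  "kahler_form x y = Jmul x \<bullet> y"

definition nondegenerate_on :: "(complex^'n) set \<Rightarrow> bool" where
  "nondegenerate_on W \<longleftrightarrow> (\<forall>x\<in>W. (\<forall>y\<in>W. kahler_form x y = 0) \<longrightarrow> x = 0)"


section \<open>The unitary groups and their orbits\<close>

definition unitary_group :: "(complex^'n^'n) set" where
  "unitary_group = {A. (\<chi> i j. cnj (A $ j $ i)) ** A = mat 1}"

definition special_unitary_group :: "(complex^'n^'n) set" where
  "special_unitary_group = {A \<in> unitary_group. det A = 1}"

definition subspace_orbit :: "(complex^'n^'n) set \<Rightarrow> (complex^'n) set \<Rightarrow> (complex^'n) set set" where
  "subspace_orbit G W = {(\<lambda>x. A *v x) ` W | A. A \<in> G}"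


section \<open>Kaehler angles\<close>

(* Bases of n-dimensional real subspaces of complex^'n are indexed by 'n itself, so that
   they can serve as the columns of a square complex matrix. *)
definition orthonormal_basis_of :: "(complex^'n) set \<Rightarrow> ('n \<Rightarrow> complex^'n) \<Rightarrow> bool" where
  "orthonormal_basis_of W w \<longleftrightarrow>
     (\<forall>j k. w j \<bullet> w k = (if j = k then 1 else 0)) \<and> span (range w) = W"

definition orthogonal_projection :: "(complex^'n) set \<Rightarrow> complex^'n \<Rightarrow> complex^'n" where
  "orthogonal_projection W x = (THE y. y \<in> W \<and> x - y \<in> W\<^sup>\<bottom>)"

definition characteristic_poly :: "complex^'n^'n \<Rightarrow> complex poly" where
  "characteristic_poly A = det (mat [:0, 1:] - (\<chi> j k. [:A $ j $ k:]))"

(* Complex eigenvalues, with multiplicity, of a real endomorphism T of the n-dimensional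
   real subspace W. The matrix of T is taken in some orthonormal basis; the
   characteristic polynomial does not depend on which one. *)
definition eigenvalues_on ::
  "(complex^'n) set \<Rightarrow> (complex^'n \<Rightarrow> complex^'n) \<Rightarrow> complex multiset" where
  "eigenvalues_on W T =
     (let w = (SOME w. orthonormal_basis_of W w)
      in proots (characteristic_poly (\<chi> j k. complex_of_real (w j \<bullet> T (w k)))))"

(* The angle theta_j is the entry with index j - 1 of the list. *)
definition kahler_angles :: "(complex^'n) set \<Rightarrow> real list" where
  "kahler_angles W = (THE \<theta>.
     length \<theta> = CARD('n) div 2 \<and> sorted \<theta> \<and> set \<theta> \<subseteq> {0..pi/2} \<and>
     eigenvalues_on W (\<lambda>x. orthogonal_projection W (Jmul x)) =
       mset (map (\<lambda>t. \<i> * complex_of_real (cos t)) \<theta>) +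
       mset (map (\<lambda>t. - (\<i> * complex_of_real (cos t))) \<theta>) +
       (if odd CARD('n) then {#0#} else {#}))"


section \<open>The Theta invariant\<close>

(* Value of the m-th exterior power of the Kaehler form on v 0, ..., v (2 m - 1). *)
definition kahler_form_power :: "nat \<Rightarrow> (nat \<Rightarrow> complex^'n) \<Rightarrow> real" where
  "kahler_form_power m v =
     (\<Sum>p | p permutes {..<2*m}.
        of_int (sign p) * (\<Prod>k<m. kahler_form (v (p (2*k))) (v (p (2*k+1))))) / 2^m"

(* The linear order on 'n orders both the coordinates of complex^'n and the vectors of a
   basis indexed by 'n: the sign of the exterior power depends on it. *)
definition positively_oriented :: "('n::{finite,linorder} \<Rightarrow> (complex, 'n) vec) \<Rightarrow> bool" where
  "positively_oriented w \<longleftrightarrow>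
     kahler_form_power (CARD('n) div 2) (\<lambda>k. w (sorted_list_of_set UNIV ! k)) > 0"

(* The set of all admissible determinants. An element z of the complex numbers is
   represented by {z}, an element of their quotient by {1,-1} by its class {z,-z}. *)
definition Theta :: "(complex, 'n::{finite,linorder}) vec set \<Rightarrow> complex set" where
  "Theta W = {det (\<chi> i j. w j $ i) | w.
     orthonormal_basis_of W w \<and> (nondegenerate_on W \<longrightarrow> positively_oriented w)}"

definition theta_value :: "bool \<Rightarrow> complex \<Rightarrow> complex set" where
  "theta_value signed z = (if signed then {z} else {z, - z})"

(* Theta (W\<^sup>\<bottom>) = Theta W holds only for even n: for odd n, passing to the orthogonal
   complement multiplies the class of Theta modulo {1,-1} by i. An example is W = R^n, with
   complement i R^n and the determinants 1 and i^n. *)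
lemma Theta_orthogonal_comp_neq_of_odd:
  assumes "odd CARD('n::{finite,linorder})"
  shows "\<exists>W \<in> (Gr CARD('n) :: (complex, 'n) vec set set). Theta (W\<^sup>\<bottom>) \<noteq> Theta W"
proof -
  define W :: "(complex, 'n) vec set" where "W = {x. \<forall>i. Im (x $ i) = 0}"
  define U :: "(complex, 'n) vec set" where "U = {x. \<forall>i. Re (x $ i) = 0}"
  have subW: "subspace W"
    by (auto simp: W_def subspace_def)
  have subU: "subspace U"
    by (auto simp: U_def subspace_def)
  have bas: "orthonormal_basis_of S (\<lambda>j. axis j c)"
    if S: "subspace S" and c: "cmod c = 1" and mem: "\<And>j. axis j c \<in> S"
      and coord: "\<And>x i. x \<in> S \<Longrightarrow> \<exists>r::real. x $ i = r *\<^sub>R c"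
    for S :: "(complex, 'n) vec set" and c
  proof -
    have "axis j c \<bullet> (axis k c :: (complex, 'n) vec) = (if j = k then 1 else 0)" for j k
      using c by (auto simp: inner_axis_axis dot_square_norm)
    moreover have "span (range (\<lambda>j. axis j c :: (complex, 'n) vec)) = S"
    proof
      show "span (range (\<lambda>j. axis j c :: (complex, 'n) vec)) \<subseteq> S"
        using S mem by (intro span_minimal) auto
      show "S \<subseteq> span (range (\<lambda>j. axis j c :: (complex, 'n) vec))"
      proof
        fix x assume "x \<in> S"
        then obtain r where r: "\<And>i. x $ i = r i *\<^sub>R c"
          using coord by metis
        have "x = (\<Sum>j\<in>UNIV. r j *\<^sub>R axis j c)"
          by (simp add: vec_eq_iff r axis_def if_distrib if_distribR sum.delta' cong: if_cong)
        then show "x \<in> span (range (\<lambda>j. axis j c :: (complex, 'n) vec))"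
          by (metis (no_types, lifting) rangeI span_base span_scale span_sum)
      qed
    qed
    ultimately show ?thesis
      by (simp add: orthonormal_basis_of_def)
  qed
  have basW: "orthonormal_basis_of W (\<lambda>j. axis j 1)"
    by (rule bas[OF subW]) (auto simp: W_def axis_def complex_eq_iff)
  have basU: "orthonormal_basis_of U (\<lambda>j. axis j \<i>)"
    by (rule bas[OF subU]) (auto simp: U_def axis_def complex_eq_iff)
  have Wperp: "W\<^sup>\<bottom> = U"
  proof
    show "U \<subseteq> W\<^sup>\<bottom>"
      by (auto simp: U_def W_def orthogonal_comp_def orthogonal_def inner_vec_def inner_complex_def)
    show "W\<^sup>\<bottom> \<subseteq> U"
    proof
      fix x assume x: "x \<in> W\<^sup>\<bottom>"
      have "Re (x $ i) = 0" for i
      proof -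
        have "axis i 1 \<in> W"
          by (auto simp: W_def axis_def)
        then have "axis i 1 \<bullet> x = 0"
          using x by (auto simp: orthogonal_comp_def orthogonal_def)
        then show ?thesis
          by (simp add: inner_axis' inner_complex_def)
      qed
      then show "x \<in> U"
        by (simp add: U_def)
    qed
  qed
  have dimW: "dim W = CARD('n)"
  proof -
    let ?e = "\<lambda>j::'n. axis j (1::complex)"
    have ort: "?e j \<bullet> ?e k = (if j = k then 1 else 0)" for j k
      using basW by (auto simp: orthonormal_basis_of_def)
    have sp: "span (range ?e) = W"
      using basW by (auto simp: orthonormal_basis_of_def)
    have "inj ?e"
      by (rule injI) (metis ort zero_neq_one)
    moreover have "independent (range ?e)"
    proof (rule pairwise_orthogonal_independent)
      show "pairwise orthogonal (range ?e)"
        by (auto simp: pairwise_def orthogonal_def ort)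
      show "0 \<notin> range ?e"
        by (metis (no_types, lifting) imageE inner_zero_left ort zero_neq_one)
    qed
    ultimately show ?thesis
      using dim_span_eq_card_independent sp card_image by metis
  qed
  have Im0: "Im z = 0" if zT: "z \<in> Theta W" for z
  proof -
    obtain w where w: "orthonormal_basis_of W w" and z: "z = det (\<chi> i j. w j $ i)"
      using zT unfolding Theta_def by blast
    have "w j \<in> W" for j
      using w by (metis orthonormal_basis_of_def rangeI span_base)
    then have "w j $ i \<in> \<real>" for i j
      by (simp add: W_def complex_is_Real_iff)
    then have "z \<in> \<real>"
      unfolding z det_def by (auto intro!: sum_in_Reals Reals_mult prod_in_Reals)
    then show ?thesis
      by (simp add: complex_is_Real_iff)
  qed
  have "\<not> nondegenerate_on U"
  proof -
    have "kahler_form x y = 0" if "x \<in> U" "y \<in> U" for x y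
      using that by (auto simp: kahler_form_def Jmul_def U_def inner_vec_def inner_complex_def)
    moreover have "axis undefined \<i> \<in> U" "axis undefined \<i> \<noteq> (0 :: (complex, 'n) vec)"
      by (auto simp: U_def axis_def vec_eq_iff)
    ultimately show ?thesis
      unfolding nondegenerate_on_def by blast
  qed
  then have "det (\<chi> i j. axis j \<i> $ i :: ((complex, 'n) vec, 'n) vec) \<in> Theta U"
    using basU by (auto simp: Theta_def)
  moreover have "det (\<chi> i j. axis j \<i> $ i :: ((complex, 'n) vec, 'n) vec) = \<i> ^ CARD('n)"
    by (subst det_diagonal) (auto simp: axis_def)
  moreover have "Im (\<i> ^ CARD('n)) \<noteq> 0"
  proof -
    obtain m where "CARD('n) = 2 * m + 1"
      using assms oddE by blast
    then have "\<i> ^ CARD('n) = (-1) ^ m * \<i>"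
      by (simp add: power_mult)
    moreover have "(-1) ^ m = (1::complex) \<or> (-1) ^ m = (-1::complex)"
      by (metis neg_one_even_power neg_one_odd_power)
    ultimately show ?thesis
      by auto
  qed
  ultimately have "Theta (W\<^sup>\<bottom>) \<noteq> Theta W"
    using Im0 Wperp by metis
  then show ?thesis
    using subW dimW by (auto simp: Gr_def)
qed

end

theory Submission
  imports Defs
begin

text \<open>
  Maximising the Kaehler form over pairs of unit vectors of \<open>W\<close> and recursing on the orthogonal
  complement yields an orthonormal basis of \<open>W\<close> in which the form is block diagonal with entries
  \<open>cos \<theta>\<^sub>j\<close>. Such a basis is obtained from a unitary matrix with columns \<open>f\<^sub>k\<close> as
  \<open>f\<^sub>2\<^sub>j\<close>, \<open>i cos \<theta>\<^sub>j f\<^sub>2\<^sub>j + sin \<theta>\<^sub>j f\<^sub>2\<^sub>j\<^sub>+\<^sub>1\<close> (and the last column if \<open>n\<close> is odd), so its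
  determinant is the determinant of \<open>f\<close> times the product of the sines. Hence \<open>W\<close> is determined by
  its angles and a unitary matrix; \<open>\<Theta>\<close> records the determinant of that matrix except when a sine
  vanishes, and then the phase of one of the columns is irrelevant. The complement of \<open>W\<close> is given
  by the matrix with columns \<open>i f\<^sub>2\<^sub>j\<^sub>+\<^sub>1\<close>, \<open>i f\<^sub>2\<^sub>j\<close>. For \<open>k < n\<close> some complex line is
  orthogonal to \<open>W\<close>, and changing its phase adjusts the determinant of a unitary map without
  moving \<open>W\<close>; for \<open>k > n\<close> the same applies to the complement of \<open>W\<close>.
\<close>


section \<open>Pairing of the index type\<close>

text \<open>The definitions contain choices that must be removed: \<open>kahler_angles\<close> is a
  definite description over the spectrum in an arbitrary basis, and \<open>Theta\<close> collects
  the determinants of all admissible bases. Canonical bases settle both. The spectrum is carried to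
  a canonical basis by similarity, and the sorted list is recovered from it: positive imaginary
  parts give the angles below \<open>pi/2\<close>, the length gives the number of the others. As for
  \<open>Theta\<close>, the top exterior power of the Kaehler form scales by the determinant of a
  real change of basis and is positive on a nondegenerate canonical basis, so there the admissible
  bases are those with change determinant 1, and no sign is lost. Frame vectors are combinations of
  columns with coefficients fixed by the angles, so a unitary \<open>g\<close> turns the matrix
  \<open>F\<close> into \<open>g ** F\<close>, and part (1) asks which determinants of
  \<open>F\<close> occur for one subspace. Besides the phases freed by a vanishing sine, a
  degenerate subspace leaves a sign free: its last frame vector can be negated by negating one
  column.\<close>

definition en :: "nat \<Rightarrow> 'n::{finite,linorder}" where
  "en k = sorted_list_of_set UNIV ! k"

text \<open>Ranks start at 0 and follow the list read by \<open>positively_oriented\<close>, so an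
  even rank marks the first member of a pair both here and in the orientation.\<close>

definition rk :: "'n::{finite,linorder} \<Rightarrow> nat" where
  "rk j = inv_into {..<CARD('n)} en j"

lemma bij_betw_en: "bij_betw (en :: nat \<Rightarrow> 'n::{finite,linorder}) {..<CARD('n)} UNIV"
  unfolding en_def by (rule bij_betw_nth) auto

lemma rk_less: "rk (j::'n::{finite,linorder}) < CARD('n)"
  unfolding rk_def
  by (metis (mono_tags) UNIV_I bij_betw_en bij_betw_def inv_into_into lessThan_iff)

lemma en_rk [simp]: "en (rk j) = j"
  unfolding rk_def by (metis UNIV_I bij_betw_en bij_betw_def f_inv_into_f)

lemma rk_en [simp]: "k < CARD('n) \<Longrightarrow> rk (en k :: 'n::{finite,linorder}) = k"
  unfolding rk_def by (metis bij_betw_en bij_betw_def inv_into_f_f lessThan_iff)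

lemma rk_eq_iff [simp]: "rk i = rk j \<longleftrightarrow> i = j"
  by (metis en_rk)

(* For odd CARD('n) the index of the largest rank is its own mate. *)
definition mate :: "'n::{finite,linorder} \<Rightarrow> 'n" where
  "mate j = (if odd (rk j) then en (rk j - 1)
             else if rk j + 1 < CARD('n) then en (rk j + 1) else j)"

lemma rk_mate:
  "rk (mate (j::'n::{finite,linorder})) =
     (if odd (rk j) then rk j - 1 else if rk j + 1 < CARD('n) then rk j + 1 else rk j)"
  using rk_less[of j] by (auto simp: mate_def)

lemma mate_mate [simp]: "mate (mate j) = j"
  by (subst rk_eq_iff[symmetric], use rk_less[of j] in \<open>auto simp: rk_mate elim: oddE\<close>)

lemma mate_eq_iff: "mate j = k \<longleftrightarrow> j = mate k"
  by (metis mate_mate)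

lemma mate_eq_mate_iff: "mate j = mate k \<longleftrightarrow> j = k"
  by (metis mate_mate)

lemma mate_fixed_iff: "mate (j::'n::{finite,linorder}) = j \<longleftrightarrow> rk j + 1 = CARD('n) \<and> even (rk j)"
  by (subst rk_eq_iff[symmetric], use rk_less[of j] in \<open>auto simp: rk_mate elim: oddE\<close>)

lemma mate_neq_if_odd: "odd (rk j) \<Longrightarrow> mate j \<noteq> j"
  by (simp add: mate_fixed_iff)

lemma even_rk_mate: "mate j \<noteq> j \<Longrightarrow> even (rk (mate j)) \<longleftrightarrow> odd (rk j)"
  by (auto simp: mate_fixed_iff rk_mate) (use rk_less[of j] in auto)

lemma rk_mate_div_2: "rk (mate j) div 2 = rk j div 2"
  by (auto simp: rk_mate elim!: oddE evenE)

lemma permutes_mate: "mate permutes UNIV"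
  by (rule bij_imp_permutes) (auto intro: involuntory_imp_bij)

text \<open>The involution is a product of disjoint transpositions, one for each pair. The sign
  enters when the complement exchanges the columns of each pair.\<close>

lemma sign_mate: "sign (mate :: 'n \<Rightarrow> 'n::{finite,linorder}) = (- 1) ^ (CARD('n) div 2)"
proof -
  \<comment> \<open>\<open>q a\<close> exchanges only the first \<open>a\<close> pairs, so each
    induction step composes with one transposition.\<close>
  define q :: "nat \<Rightarrow> 'n \<Rightarrow> 'n" where "q a j = (if rk j < 2 * a then mate j else j)" for a j
  have "permutation (q a) \<and> sign (q a) = (- 1) ^ a" if "a \<le> CARD('n) div 2" for a
    using that
  proof (induction a)
    case 0
    have "q 0 = id" by (auto simp: q_def)
    then show ?case by simp
  next
    case (Suc a)
    let ?u = "en (2 * a) :: 'n" and ?v = "en (2 * a + 1) :: 'n"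
    have lt: "2 * a + 1 < CARD('n)" using Suc.prems by auto
    then have ru: "rk ?u = 2 * a" and rv: "rk ?v = 2 * a + 1" by auto
    then have uv: "?u \<noteq> ?v" by (metis n_not_Suc_n Suc_eq_plus1)
    have mu: "mate ?u = ?v" and mv: "mate ?v = ?u"
      using lt ru rv by (auto simp: mate_def)
    have eq: "q (Suc a) = Transposition.transpose ?u ?v \<circ> q a"
    proof
      fix j
      consider "rk j < 2 * a" | "j = ?u" | "j = ?v" | "rk j > 2 * a + 1"
        by (metis Suc_eq_plus1 antisym_conv3 en_rk less_Suc_eq)
      then show "q (Suc a) j = (Transposition.transpose ?u ?v \<circ> q a) j"
      proof cases
        case 1
        then have "rk (mate j) < 2 * a"
          by (auto simp: rk_mate elim!: evenE)
        then have "mate j \<noteq> ?u" "mate j \<noteq> ?v" using ru rv by auto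
        then show ?thesis using 1 by (simp add: q_def)
      next
        case 4
        then have "j \<noteq> ?u" "j \<noteq> ?v" using ru rv by auto
        then show ?thesis using 4 by (simp add: q_def)
      qed (use ru rv mu mv in \<open>simp_all add: q_def\<close>)
    qed
    have "permutation (q a)" "sign (q a) = (- 1) ^ a"
      using Suc by auto
    then show ?case
      unfolding eq using uv
      by (auto simp only: sign_compose permutation_swap_id sign_swap_id permutation_compose
          power_Suc if_False)
  qed
  moreover have "q (CARD('n) div 2) = mate"
  proof
    fix j
    show "q (CARD('n) div 2) j = mate j"
    proof (cases "rk j < 2 * (CARD('n) div 2)")
      \<comment> \<open>Only the last index of an odd-sized type gets here.\<close>
      case False
      then have "mate j = j"
        using rk_less[of j] by (auto simp: mate_fixed_iff) presburger+
      then show ?thesis by (simp add: q_def)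
    qed (simp add: q_def)
  qed
  ultimately show ?thesis by (metis order_refl)
qed


section \<open>Triangular determinants and characteristic polynomials\<close>

(* The library versions need a well-ordered index type. *)
lemma det_triangular:
  fixes A :: "'a::comm_ring_1^'n^'n" and r :: "'n \<Rightarrow> nat"
  assumes r: "inj r" and A: "\<And>i j. r i < r j \<Longrightarrow> A $ i $ j = 0"
  shows "det A = (\<Prod>i\<in>UNIV. A $ i $ i)"
proof -
  have "(\<Prod>i\<in>UNIV. A $ i $ p i) = 0" if p: "p permutes UNIV" "p \<noteq> id" for p
  proof -
    \<comment> \<open>If no rank were raised, the equality of the two sums of ranks would fix every
      rank.\<close>
    obtain i where "r i < r (p i)"
    proof (rule ccontr)
      assume "\<not> thesis"
      then have le: "\<And>i. r (p i) \<le> r i"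
        using that not_le by blast
      have "(\<Sum>i\<in>UNIV. r (p i)) = (\<Sum>i\<in>UNIV. r i)"
        using sum.permute[OF p(1), of r] by (simp add: comp_def)
      then have "r (p i) = r i" for i
        using sum_mono_inv[of "\<lambda>i. r (p i)" UNIV r i] le by simp
      then have "p = id"
        using r by (auto simp: inj_def)
      then show False using p by simp
    qed
    then show ?thesis
      using A by (intro prod_zero) auto
  qed
  then have "det A = (\<Sum>p\<in>{id}. of_int (sign p) * (\<Prod>i\<in>UNIV. A $ i $ p i))"
    unfolding det_def by (intro sum.mono_neutral_right) (auto simp: permutes_id)
  then show ?thesis by simp
qed

lemma det_triangular':
  fixes A :: "'a::comm_ring_1^'n^'n" and r :: "'n \<Rightarrow> nat"
  assumes "inj r" "\<And>i j. r j < r i \<Longrightarrow> A $ i $ j = 0"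
  shows "det A = (\<Prod>i\<in>UNIV. A $ i $ i)"
proof -
  have "det (Finite_Cartesian_Product.transpose A) = (\<Prod>i\<in>UNIV. A $ i $ i)"
    by (subst det_triangular[OF assms(1)]) (simp_all add: assms(2) Finite_Cartesian_Product.transpose_def)
  then show ?thesis by simp
qed

lemma inj_rk: "inj rk"
  by (simp add: inj_def)

text \<open>Constant embedding into polynomial matrices is multiplicative and the scalar matrix
  \<open>X\<close> commutes with everything, so the similarity passes to \<open>X - A\<close>; after
  taking determinants, the nonzero constant \<open>det U\<close> cancels. A complex \<open>U\<close>
  is allowed, which the eigenvectors of real skew blocks require.\<close>

lemma characteristic_poly_similar:
  fixes A D U :: "complex^'n^'n"
  assumes "A ** U = U ** D" and "det U \<noteq> 0"
  shows "characteristic_poly A = characteristic_poly D"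
proof -
  let ?C = "\<lambda>A :: complex^'n^'n. (\<chi> j k. [:A $ j $ k:]) :: complex poly^'n^'n"
  have C_mult: "?C (A ** B) = ?C A ** ?C B" for A B
  proof -
    have "(\<Sum>k\<in>S. [:f k:]) = [:\<Sum>k\<in>S. f k:]" if "finite S" for f :: "'n \<Rightarrow> complex" and S
      using that by induction simp_all
    then show ?thesis by (simp add: matrix_matrix_mult_def mult.commute)
  qed
  have mult_X: "mat X ** B = B ** mat X" for X :: "complex poly" and B :: "complex poly^'n^'n"
    by (simp add: matrix_matrix_mult_def mat_def if_distrib if_distribR sum.delta sum.delta'
        mult.commute cong: if_cong)
  have sub: "(X - Y) ** Z = X ** Z - Y ** Z" "Z ** (X - Y) = Z ** X - Z ** Y"
    for X Y Z :: "complex poly^'n^'n"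
    by (simp_all add: vec_eq_iff matrix_matrix_mult_def left_diff_distrib right_diff_distrib
        sum_subtractf)
  have "(mat [:0, 1:] - ?C A) ** ?C U = ?C U ** (mat [:0, 1:] - ?C D)"
    unfolding sub mult_X[of "[:0, 1:]" "?C U"] C_mult[symmetric] assms(1) ..
  then have "characteristic_poly A * det (?C U) = det (?C U) * characteristic_poly D"
    unfolding characteristic_poly_def det_mul[symmetric] by (rule arg_cong)
  moreover have "det (?C U) = [:det U:]"
  proof -
    have "(\<Prod>i\<in>S. [:f i:]) = [:\<Prod>i\<in>S. f i:]" if "finite S" for f :: "'n \<Rightarrow> complex" and S
      using that by induction (auto simp: mult.commute)
    moreover have "(\<Sum>p\<in>P. of_int (s p) * [:f p:]) = [:\<Sum>p\<in>P. of_int (s p) * f p:]"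
      if "finite P" for f :: "('n \<Rightarrow> 'n) \<Rightarrow> complex" and s P
      using that by induction (simp_all add: of_int_poly)
    ultimately show ?thesis
      unfolding det_def by simp
  qed
  ultimately show ?thesis
    using assms(2) by (metis mult.commute mult_cancel_right pCons_eq_0_iff)
qed

lemma proots_characteristic_poly_triangular:
  fixes D :: "((complex, 'n::{finite,linorder}) vec, 'n) vec"
  assumes "\<And>i j. rk j < rk i \<Longrightarrow> D $ i $ j = 0"
  shows "proots (characteristic_poly D) = (\<Sum>j\<in>UNIV. {#D $ j $ j#})"
proof -
  have "characteristic_poly D = (\<Prod>j\<in>UNIV. [:- D $ j $ j, 1:])"
    unfolding characteristic_poly_def
    by (subst det_triangular'[OF inj_rk]) (use assms in \<open>auto simp: mat_def intro!: prod.cong\<close>)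
  then show ?thesis
    by (simp add: proots_prod)
qed


section \<open>Hermitian product and unitary matrices\<close>

text \<open>Conjugate-linear in the first argument: with the opposite convention the Kaehler form
  would be minus the imaginary part.\<close>

definition hprod :: "complex^'n \<Rightarrow> complex^'n \<Rightarrow> complex" where
  "hprod x y = (\<Sum>i\<in>UNIV. cnj (x $ i) * y $ i)"

lemma hprod_eq_Complex: "hprod x y = Complex (x \<bullet> y) (kahler_form x y)"
  by (simp add: complex_eq_iff hprod_def kahler_form_def Jmul_def inner_vec_def inner_complex_def
      algebra_simps)

lemma hprod_add_left: "hprod (x + y) z = hprod x z + hprod y z"
  and hprod_add_right: "hprod z (x + y) = hprod z x + hprod z y"
  and hprod_diff_left: "hprod (x - y) z = hprod x z - hprod y z"
  and hprod_diff_right: "hprod z (x - y) = hprod z x - hprod z y"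
  and hprod_smult_left: "hprod (c *s x) z = cnj c * hprod x z"
  and hprod_smult_right: "hprod z (c *s x) = c * hprod z x"
  by (simp_all add: hprod_def sum.distrib sum_subtractf sum_distrib_left algebra_simps)

lemma hprod_zero_right [simp]: "hprod x 0 = 0"
  by (simp add: hprod_def)

lemma hprod_commute: "hprod y x = cnj (hprod x y)"
  by (simp add: hprod_def mult.commute)

lemma hprod_self: "hprod x x = complex_of_real ((norm x)\<^sup>2)"
proof -
  have "kahler_form x x = 0"
    by (simp add: kahler_form_def Jmul_def inner_vec_def inner_complex_def)
  then show ?thesis
    by (simp add: hprod_eq_Complex power2_norm_eq_inner complex_eq_iff)
qed

lemma hprod_scaleR_right: "hprod x (r *\<^sub>R y) = of_real r * hprod x y"
  by (simp add: hprod_def sum_distrib_left scaleR_conv_of_real[where 'a=complex] algebra_simps)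

lemma bilinear_kahler_form: "bilinear kahler_form"
  by (auto simp: bilinear_def linear_iff kahler_form_def Jmul_def inner_vec_def inner_complex_def
      algebra_simps sum.distrib sum_subtractf sum_distrib_left)

lemma kahler_form_commute: "kahler_form y x = - kahler_form x y"
  by (simp add: kahler_form_def Jmul_def inner_vec_def inner_complex_def algebra_simps
      flip: sum_negf)

section \<open>Adjoints and unitary matrices\<close>

definition adj :: "complex^'n^'m \<Rightarrow> complex^'m^'n" where
  "adj A = (\<chi> i j. cnj (A $ j $ i))"

lemma adj_nth [simp]: "adj A $ i $ j = cnj (A $ j $ i)"
  by (simp add: adj_def)

lemma adj_adj [simp]: "adj (adj A) = A"
  by (simp add: vec_eq_iff)

lemma det_adj: "det (adj A) = cnj (det A)"
proof -
  have "det (adj A) = det (Finite_Cartesian_Product.transpose (adj A))"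
    by simp
  also have "\<dots> = cnj (det A)"
    by (simp add: det_def Finite_Cartesian_Product.transpose_def)
  finally show ?thesis .
qed

lemma unitary_iff: "A \<in> unitary_group \<longleftrightarrow> adj A ** A = mat 1"
  by (simp add: unitary_group_def adj_def)

lemma unitary_right: "A \<in> unitary_group \<Longrightarrow> A ** adj A = mat 1"
  using matrix_left_right_inverse unitary_iff by blast

lemma unitary_adj: "A \<in> unitary_group \<Longrightarrow> adj A \<in> unitary_group"
  using unitary_right by (auto simp: unitary_iff)

lemma adj_mult: "adj (A ** B) = adj B ** adj A"
  by (simp add: vec_eq_iff matrix_matrix_mult_def mult.commute)

lemma unitary_mult:
  assumes "A \<in> unitary_group" "B \<in> unitary_group"
  shows "A ** B \<in> unitary_group"
proof -
  have "adj (A ** B) ** (A ** B) = adj B ** (adj A ** A) ** B"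
    by (simp add: adj_mult matrix_mul_assoc)
  then show ?thesis
    using assms by (simp add: unitary_iff)
qed

lemma cmod_det_unitary:
  assumes "A \<in> unitary_group"
  shows "cmod (det A) = 1"
proof -
  have "cnj (det A) * det A = 1"
    using assms by (metis det_I det_adj det_mul unitary_iff)
  then have "(cmod (det A))\<^sup>2 = 1"
    by (metis complex_norm_square mult.commute of_real_eq_1_iff)
  then show ?thesis
    by (simp add: power2_eq_1_iff) (metis norm_ge_zero not_one_le_zero neg_0_le_iff_le order_trans)
qed

lemma unitary_iff_columns:
  "A \<in> unitary_group \<longleftrightarrow> (\<forall>j k. hprod (column j A) (column k A) = (if j = k then 1 else 0))"
  by (auto simp: unitary_iff vec_eq_iff hprod_def column_def matrix_matrix_mult_def mat_def)

lemma hprod_adjoint: "hprod (A *v x) y = hprod x (adj A *v y)"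
proof -
  have "hprod (A *v x) y = (\<Sum>i\<in>UNIV. \<Sum>j\<in>UNIV. cnj (A $ i $ j) * cnj (x $ j) * y $ i)"
    by (simp add: hprod_def matrix_vector_mult_def sum_distrib_right)
  also have "\<dots> = (\<Sum>j\<in>UNIV. \<Sum>i\<in>UNIV. cnj (A $ i $ j) * cnj (x $ j) * y $ i)"
    by (rule sum.swap)
  also have "\<dots> = hprod x (adj A *v y)"
    by (simp add: hprod_def matrix_vector_mult_def sum_distrib_left mult_ac)
  finally show ?thesis .
qed

lemma unitary_cancel:
  assumes "A \<in> unitary_group"
  shows "adj A *v (A *v x) = x" "A *v (adj A *v x) = x"
  using assms unitary_right[OF assms] by (simp_all add: matrix_vector_mul_assoc unitary_iff)

lemma hprod_unitary: "A \<in> unitary_group \<Longrightarrow> hprod (A *v x) (A *v y) = hprod x y"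
  by (simp add: hprod_adjoint unitary_cancel)

lemma inner_unitary: "A \<in> unitary_group \<Longrightarrow> (A *v x) \<bullet> (A *v y) = x \<bullet> y"
  using hprod_unitary[of A x y] by (simp add: hprod_eq_Complex)

lemma linear_matrix_vector: "linear ((*v) (A :: complex^'n^'m))"
  by (rule linearI) (simp_all add: vec_eq_iff matrix_vector_mult_def sum.distrib
      scaleR_conv_of_real[where 'a=complex] sum_distrib_left algebra_simps)

text \<open>Fewer than n complex linear equations have a nonzero solution: padding with zero rows
  gives a singular square matrix.\<close>

lemma exists_hprod_orthogonal:
  fixes f :: "'n \<Rightarrow> complex^'n"
  assumes "S \<noteq> UNIV"
  obtains x where "norm x = 1" "\<And>j. j \<in> S \<Longrightarrow> hprod (f j) x = 0"
proof -
  define A :: "complex^'n^'n" where "A = (\<chi> i j. if i \<in> S then cnj (f i $ j) else 0)"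
  obtain i where "i \<notin> S" using assms by auto
  then have "row i A = 0"
    by (simp add: row_def A_def vec_eq_iff)
  then have "det A = 0"
    by (rule det_zero_row)
  then have "\<not> (\<exists>B. B ** A = mat 1)"
    by (metis invertible_det_nz invertible_left_inverse)
  then obtain y where y: "A *v y = 0" "y \<noteq> 0"
    unfolding matrix_left_invertible_ker by auto
  have orth: "hprod (f j) y = 0" if "j \<in> S" for j
  proof -
    have "(A *v y) $ j = 0" using y by simp
    then show ?thesis
      using that by (simp add: A_def hprod_def matrix_vector_mult_def)
  qed
  show ?thesis
  proof
    show "norm (inverse (norm y) *\<^sub>R y) = 1"
      using y by simp
    show "hprod (f j) (inverse (norm y) *\<^sub>R y) = 0" if "j \<in> S" for j
      using orth[OF that] by (simp add: hprod_scaleR_right)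
  qed
qed

text \<open>The missing columns are filled one at a time by unit vectors orthogonal to those
  present. This allows prescribing just the columns that a canonical basis determines.\<close>

lemma unitary_completion:
  fixes f :: "'n \<Rightarrow> complex^'n"
  assumes "\<And>j k. j \<in> S \<Longrightarrow> k \<in> S \<Longrightarrow> hprod (f j) (f k) = (if j = k then 1 else 0)"
  obtains F where "F \<in> unitary_group" "\<And>j. j \<in> S \<Longrightarrow> column j F = f j"
proof -
  have "\<exists>F\<in>unitary_group. \<forall>j\<in>S. column j F = f j"
    using assms
  proof (induction "card (- S)" arbitrary: S f)
    case 0
    then have "- S = {}" by simp
    then have "S = UNIV" by blast
    moreover have "column j (\<chi> i j. f j $ i) = f j" for j
      by (simp add: column_def vec_eq_iff)
    ultimately show ?case
      using 0 by (intro bexI[of _ "\<chi> i j. f j $ i"]) (auto simp: unitary_iff_columns)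
  next
    case (Suc d)
    then have "S \<noteq> UNIV" by auto
    then obtain i where i: "i \<notin> S" by auto
    obtain x where x: "norm x = 1" "\<And>j. j \<in> S \<Longrightarrow> hprod (f j) x = 0"
      using exists_hprod_orthogonal \<open>S \<noteq> UNIV\<close> by blast
    have x': "hprod x (f j) = 0" if "j \<in> S" for j
      using x(2)[OF that] hprod_commute[of x "f j"] by simp
    have "card (- insert i S) = d"
    proof -
      have "- S = insert i (- insert i S)" using i by auto
      then have "card (- S) = Suc (card (- insert i S))"
        by (metis ComplD card_insert_disjoint finite insertI1)
      then show ?thesis
        using Suc.hyps(2) by simp
    qed
    moreover have "hprod ((f(i := x)) j) ((f(i := x)) k) = (if j = k then 1 else 0)"
      if "j \<in> insert i S" "k \<in> insert i S" for j k
      using that Suc.prems x x' i hprod_self[of x] by auto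
    ultimately obtain F where "F \<in> unitary_group" "\<forall>j\<in>insert i S. column j F = (f(i := x)) j"
      using Suc.hyps(1)[of "insert i S" "f(i := x)"] by blast
    then show ?case
      using i by (intro bexI[of _ F]) auto
  qed
  then show ?thesis using that by blast
qed

text \<open>The device for adjusting determinants: multiplication on the right rescales column
  \<open>k\<close> alone.\<close>

definition phase_at :: "'n \<Rightarrow> complex \<Rightarrow> complex^'n^'n" where
  "phase_at k c = (\<chi> i j. if i = j then if j = k then c else 1 else 0)"

lemma det_phase_at: "det (phase_at k c) = c"
  by (simp add: phase_at_def det_diagonal prod.delta cong: if_cong)

lemma column_mult: "column j (A ** B) = A *v column j B"
  by (simp add: column_def vec_eq_iff matrix_matrix_mult_def matrix_vector_mult_def)

lemma column_phase_at:
  "column j (F ** phase_at k c) = (if j = k then c *s column j F else column j F)"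
  by (simp add: column_def vec_eq_iff matrix_matrix_mult_def phase_at_def if_distrib sum.delta
      mult.commute cong: if_cong)

lemma phase_at_vector: "phase_at k c *v x = (\<chi> i. if i = k then c * x $ i else x $ i)"
proof -
  have "phase_at k c $ i $ j * x $ j = (if j = i then (if i = k then c * x $ i else x $ i) else 0)"
    for i j
    by (simp add: phase_at_def)
  then show ?thesis
    by (simp add: vec_eq_iff matrix_vector_mult_def)
qed

lemma unitary_phase_at: "cmod c = 1 \<Longrightarrow> phase_at k c \<in> unitary_group"
proof -
  assume "cmod c = 1"
  then have "cnj c * c = 1"
    by (metis complex_norm_square mult.commute of_real_1 one_power2)
  then have "column j (adj (phase_at k c) ** phase_at k c) = column j (mat 1)" for j
    unfolding column_phase_at
    by (auto simp: vec_eq_iff column_def phase_at_def mat_def mult.commute)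
  then show ?thesis
    by (simp add: unitary_iff vec_eq_iff column_def)
qed

text \<open>In a unitary basis with \<open>x\<close> as column \<open>k\<close>, the map multiplies
  coordinate \<open>k\<close> by \<open>c\<close>; vectors orthogonal to \<open>x\<close> have
  coordinate 0 there.\<close>

lemma unitary_fixing_orthogonal:
  fixes x :: "complex^'n"
  assumes "norm x = 1" "cmod c = 1"
  obtains A where "A \<in> unitary_group" "det A = c" "\<And>y. hprod x y = 0 \<Longrightarrow> A *v y = y"
proof -
  define k :: 'n where "k = undefined"
  obtain F where F: "F \<in> unitary_group" "column k F = x"
    using unitary_completion[of "{k}" "\<lambda>_. x"] assms by (auto simp: hprod_self)
  let ?A = "F ** phase_at k c ** adj F"
  show ?thesis
  proof
    show "?A \<in> unitary_group"
      using F assms by (intro unitary_mult unitary_phase_at unitary_adj)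
    have "det (F ** adj F) = 1"
      using F by (simp add: unitary_right)
    then show "det ?A = c"
      by (simp add: det_mul det_phase_at mult.commute mult.left_commute)
    show "?A *v y = y" if "hprod x y = 0" for y
    proof -
      have "(adj F *v y) $ k = 0"
        using that F by (auto simp: hprod_def matrix_vector_mult_def column_def)
      then have "phase_at k c *v (adj F *v y) = adj F *v y"
        by (simp add: phase_at_vector vec_eq_iff)
      then show ?thesis
        using F by (simp add: unitary_cancel flip: matrix_vector_mul_assoc)
    qed
  qed
qed


section \<open>Canonical bases\<close>

definition angle_list :: "nat \<Rightarrow> real list \<Rightarrow> bool" where
  "angle_list m \<theta> \<longleftrightarrow> length \<theta> = m \<and> sorted \<theta> \<and> set \<theta> \<subseteq> {0..pi/2}"

text \<open>For odd \<open>CARD('n)\<close> the unpaired index points one past the end of the list,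
  hence the guards \<open>mate j \<noteq> j\<close> and \<open>odd (rk j)\<close> wherever this is
  used.\<close>

abbreviation angle_at :: "real list \<Rightarrow> 'n::{finite,linorder} \<Rightarrow> real" where
  "angle_at \<theta> j \<equiv> \<theta> ! (rk j div 2)"

lemma angle_at_range:
  assumes "angle_list (CARD('n) div 2) \<theta>" "mate (j::'n::{finite,linorder}) \<noteq> j"
  shows "0 \<le> angle_at \<theta> j" "angle_at \<theta> j \<le> pi/2"
proof -
  have "rk j div 2 < CARD('n) div 2"
    using assms(2) rk_less[of j] by (auto simp: mate_fixed_iff) presburger
  then have "angle_at \<theta> j \<in> set \<theta>"
    using assms(1) by (auto simp: angle_list_def)
  then show "0 \<le> angle_at \<theta> j" "angle_at \<theta> j \<le> pi/2"
    using assms(1) by (auto simp: angle_list_def)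
qed

text \<open>The only possibly nonzero entry in row \<open>j\<close> of the Gram matrix of the
  Kaehler form. The sign is the skewness inside a pair; the unpaired vector lies in the
  kernel.\<close>

definition kcoeff :: "real list \<Rightarrow> 'n::{finite,linorder} \<Rightarrow> real" where
  "kcoeff \<theta> j = (if mate j = j then 0
                  else if even (rk j) then cos (angle_at \<theta> j) else - cos (angle_at \<theta> j))"

definition canonical_basis :: "real list \<Rightarrow> ('n::{finite,linorder} \<Rightarrow> (complex, 'n) vec) \<Rightarrow> bool" where
  "canonical_basis \<theta> w \<longleftrightarrow>
     (\<forall>j k. w j \<bullet> w k = (if j = k then 1 else 0)) \<and>
     (\<forall>j k. kahler_form (w j) (w k) = (if k = mate j then kcoeff \<theta> j else 0))"

text \<open>The two real conditions are the real and imaginary parts of one Hermitian product, so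
  frames can be checked by sesquilinear expansion.\<close>

lemma canonical_basis_iff_hprod:
  "canonical_basis \<theta> w \<longleftrightarrow>
     (\<forall>j k. hprod (w j) (w k) =
        (if j = k then 1 else 0) + (if k = mate j then \<i> * of_real (kcoeff \<theta> j) else 0))"
proof -
  have "hprod (w j) (w k) =
      (if j = k then 1 else 0) + (if k = mate j then \<i> * of_real (kcoeff \<theta> j) else 0)
    \<longleftrightarrow> w j \<bullet> w k = (if j = k then 1 else 0) \<and>
      kahler_form (w j) (w k) = (if k = mate j then kcoeff \<theta> j else 0)" for j k
    by (simp add: hprod_eq_Complex complex_eq_iff)
  then show ?thesis
    by (simp only: canonical_basis_def all_conj_distrib)
qed

text \<open>The Hermitian product of the two vectors of a pair is i times the cosine, and the sine
  restores unit length. At angle 0 column \<open>j\<close> drops out and the pair spans a complex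
  line; at \<open>pi/2\<close> the frame vectors are the columns themselves.\<close>

definition frame ::
  "((complex, 'n::{finite,linorder}) vec, 'n) vec \<Rightarrow> real list \<Rightarrow> 'n \<Rightarrow> (complex, 'n) vec" where
  "frame F \<theta> j = (if odd (rk j)
     then (\<i> * of_real (cos (angle_at \<theta> j))) *s column (mate j) F
          + of_real (sin (angle_at \<theta> j)) *s column j F
     else column j F)"

text \<open>The coefficients do not depend on the matrix, so forming frames is equivariant and the
  action on subspaces becomes a matrix product.\<close>

lemma frame_mult: "frame (A ** F) \<theta> j = A *v frame F \<theta> j"
proof -
  have "A *v (c *s x) = c *s (A *v x)" for c x
    by (simp add: vec_eq_iff matrix_vector_mult_def sum_distrib_left mult_ac)
  then show ?thesis
    by (simp add: frame_def column_mult matrix_vector_right_distrib)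
qed

lemma i_mult_i_mult: "\<i> * x * (\<i> * y) = - (x * y)"
  using arg_cong[OF i_squared, of "\<lambda>z. z * (x * y)"] by (simp add: mult_ac del: i_squared)

lemma canonical_basis_frame:
  fixes F :: "((complex, 'n::{finite,linorder}) vec, 'n) vec"
  assumes "F \<in> unitary_group"
  shows "canonical_basis \<theta> (frame F \<theta>)"
proof -
  have col: "hprod (column j F) (column k F) = (if j = k then 1 else 0)" for j k
    using assms by (simp add: unitary_iff_columns)
  have odd_mate: "mate j \<noteq> j" "even (rk (mate j))" if "odd (rk j)" for j :: 'n
    using that by (auto simp: mate_neq_if_odd even_rk_mate)
  have cs: "complex_of_real (cos t) * of_real (cos t) + of_real (sin t) * of_real (sin t) = 1" for t
    by (metis of_real_1 of_real_add of_real_mult power2_eq_square sin_cos_squared_add2)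
  have "hprod (frame F \<theta> j) (frame F \<theta> k) =
        (if j = k then 1 else 0) + (if k = mate j then \<i> * of_real (kcoeff \<theta> j) else 0)" for j k
  proof (cases "odd (rk j)"; cases "odd (rk k)")
    assume "odd (rk j)" "odd (rk k)"
    then show ?thesis
      using odd_mate[of j] odd_mate[of k] cs[of "angle_at \<theta> j"]
      by (auto simp: frame_def hprod_add_left hprod_add_right hprod_smult_left hprod_smult_right
          col mate_eq_iff i_mult_i_mult)
  next
    assume "odd (rk j)" "\<not> odd (rk k)"
    then show ?thesis
      using odd_mate[of j]
      by (auto simp: frame_def hprod_add_left hprod_smult_left col kcoeff_def)
  next
    assume "\<not> odd (rk j)" "odd (rk k)"
    then show ?thesis
      using odd_mate[of k] mate_eq_iff[of j k]
      by (auto simp: frame_def hprod_add_right hprod_smult_right col kcoeff_def rk_mate_div_2)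
  next
    assume "\<not> odd (rk j)" "\<not> odd (rk k)"
    then show ?thesis
      using even_rk_mate[of j] by (auto simp: frame_def col kcoeff_def)
  qed
  then show ?thesis
    by (simp add: canonical_basis_iff_hprod)
qed

text \<open>Inverts the frame formula. Columns of even rank are basis vectors; for odd rank,
  subtracting the Hermitian component along the mate leaves \<open>g j\<close>, which must be the
  sine times the missing column.\<close>

lemma canonical_basis_imp_frame:
  fixes w :: "'n::{finite,linorder} \<Rightarrow> (complex, 'n) vec"
  assumes w: "canonical_basis \<theta> w" and \<theta>: "angle_list (CARD('n) div 2) \<theta>"
  obtains F where "F \<in> unitary_group" "w = frame F \<theta>"
proof -
  let ?c = "\<lambda>j::'n. complex_of_real (cos (angle_at \<theta> j))"
  let ?s = "\<lambda>j::'n. complex_of_real (sin (angle_at \<theta> j))"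
  define g where "g j = w j - (\<i> * ?c j) *s w (mate j)" for j
  have h: "hprod (w j) (w k) =
      (if j = k then 1 else 0) + (if k = mate j then \<i> * of_real (kcoeff \<theta> j) else 0)" for j k
    using w by (simp add: canonical_basis_iff_hprod)
  have odd_mate: "mate j \<noteq> j" "even (rk (mate j))" if "odd (rk j)" for j :: 'n
    using that by (auto simp: mate_neq_if_odd even_rk_mate)
  have cs: "1 - ?c j * ?c j = ?s j * ?s j" for j
    by (metis add_diff_cancel_right' of_real_1 of_real_diff of_real_mult power2_eq_square
        sin_cos_squared_add)
  have gw: "hprod (g j) (w k) = (if j = k then ?s j * ?s j else 0)" if j: "odd (rk j)" for j k
  proof -
    have "hprod (g j) (w k) = hprod (w j) (w k) + \<i> * ?c j * hprod (w (mate j)) (w k)"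
      by (simp add: g_def hprod_diff_left hprod_smult_left)
    then show ?thesis
      using odd_mate[OF j] j cs[of j] by (auto simp: h kcoeff_def rk_mate_div_2 i_mult_i_mult)
  qed
  have gg: "hprod (g j) (g k) = (if j = k then ?s j * ?s j else 0)"
    if j: "odd (rk j)" and k: "odd (rk k)" for j k
    using odd_mate[OF k] j
    by (auto simp: g_def[of k] hprod_diff_right hprod_smult_right gw[OF j])
  have wg: "hprod (w k) (g j) = (if j = k then ?s j * ?s j else 0)" if j: "odd (rk j)" for j k
    using gw[OF j, of k] hprod_commute[of "w k" "g j"] by simp
  \<comment> \<open>A column of odd rank whose sine vanishes is not determined by \<open>w\<close>
    (there \<open>g j\<close> is 0) and is left to the completion.\<close>
  define S where "S = {j::'n. odd (rk j) \<longrightarrow> ?s j \<noteq> 0}"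
  define f where "f j = (if odd (rk j) then inverse (?s j) *s g j else w j)" for j
  have inv: "inverse s * (inverse s * (s * s)) = 1" if "s \<noteq> 0" for s :: complex
    using that by (simp add: field_simps)
  have orth: "hprod (f j) (f k) = (if j = k then 1 else 0)" if "j \<in> S" "k \<in> S" for j k
    using that even_rk_mate[of j] inv
    by (auto simp: f_def S_def hprod_smult_left hprod_smult_right gg gw wg h kcoeff_def)
  obtain F where F: "F \<in> unitary_group" "\<And>j. j \<in> S \<Longrightarrow> column j F = f j"
    using unitary_completion[of S f] orth by blast
  have "w j = frame F \<theta> j" for j
  proof (cases "odd (rk j)")
    case True
    have "mate j \<in> S" and m: "f (mate j) = w (mate j)"
      using odd_mate[OF True] by (auto simp: S_def f_def)
    then have colm: "column (mate j) F = w (mate j)"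
      using F by simp
    show ?thesis
    proof (cases "?s j = 0")
      case False
      then have "column j F = inverse (?s j) *s g j"
        using F(2)[of j] True by (simp add: S_def f_def)
      then have "?s j *s column j F = g j"
        using False by (simp add: vector_smult_assoc)
      then show ?thesis
        using True colm by (simp add: frame_def g_def)
    next
      case s0: True
      then have "hprod (g j) (g j) = 0"
        using gg[OF True True] by simp
      then have "g j = 0"
        by (simp add: hprod_self)
      then show ?thesis
        using True colm s0 by (simp add: frame_def g_def)
    qed
  next
    case False
    then show ?thesis
      using F(2)[of j] by (simp add: frame_def S_def f_def)
  qed
  then show ?thesis
    using that F by blast
qed

lemma prod_odd_half:
  "(\<Prod>k<(n::nat). if odd k then f (k div 2) else 1) = (\<Prod>j<n div 2. f j :: 'a::comm_monoid_mult)"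
  by (induction n) (auto elim!: oddE evenE simp: mult.commute)

text \<open>The frame arises from the columns of \<open>F\<close> by a matrix \<open>V\<close> that
  is triangular for the rank order, since the mate of an odd rank precedes it. The diagonal has the
  sine at odd ranks and 1 at even ranks.\<close>

lemma det_frame:
  fixes F :: "((complex, 'n::{finite,linorder}) vec, 'n) vec"
  shows "det (\<chi> i j. frame F \<theta> j $ i) = det F * of_real (\<Prod>j<CARD('n) div 2. sin (\<theta> ! j))"
proof -
  define V :: "((complex, 'n) vec, 'n) vec" where
    "V = (\<chi> l j. if l = j then (if odd (rk j) then of_real (sin (angle_at \<theta> j)) else 1)
          else if odd (rk j) \<and> l = mate j then \<i> * of_real (cos (angle_at \<theta> j)) else 0)"
  have "(F ** V) $ i $ j = frame F \<theta> j $ i" for i j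
  proof (cases "odd (rk j)")
    case True
    then have "(F ** V) $ i $ j = (\<Sum>l\<in>{mate j, j}. F $ i $ l * V $ l $ j)"
      unfolding matrix_matrix_mult_def vec_lambda_beta
      by (intro sum.mono_neutral_right) (auto simp: V_def)
    then show ?thesis
      using True mate_neq_if_odd[OF True] by (simp add: V_def frame_def column_def mult.commute)
  next
    case False
    then have "(F ** V) $ i $ j = (\<Sum>l\<in>{j}. F $ i $ l * V $ l $ j)"
      unfolding matrix_matrix_mult_def vec_lambda_beta
      by (intro sum.mono_neutral_right) (auto simp: V_def)
    then show ?thesis
      using False by (simp add: V_def frame_def column_def)
  qed
  then have "(\<chi> i j. frame F \<theta> j $ i) = F ** V"
    by (simp add: vec_eq_iff)
  moreover have "det V = of_real (\<Prod>j<CARD('n) div 2. sin (\<theta> ! j))"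
  proof -
    have "det V = (\<Prod>j\<in>UNIV. V $ j $ j)"
      by (rule det_triangular'[OF inj_rk]) (auto simp: V_def rk_mate)
    also have "\<dots> = (\<Prod>k<CARD('n). V $ en k $ en k)"
      by (rule prod.reindex_bij_betw[OF bij_betw_en, symmetric])
    also have "\<dots> = (\<Prod>k<CARD('n). if odd k then of_real (sin (\<theta> ! (k div 2))) else 1)"
      by (rule prod.cong) (auto simp: V_def)
    finally show ?thesis
      by (simp add: prod_odd_half[where f = "\<lambda>j. complex_of_real (sin (\<theta> ! j))"])
  qed
  ultimately show ?thesis
    by (simp add: det_mul)
qed

section \<open>Orthonormal bases of real n-dimensional subspaces\<close>

lemma orthonormal_basis_of_span:
  "(\<And>j k. w j \<bullet> w k = (if j = k then 1 else 0)) \<Longrightarrow> orthonormal_basis_of (span (range w)) w"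
  by (simp add: orthonormal_basis_of_def)

lemma orthonormal_expansion:
  fixes v :: "'n \<Rightarrow> complex^'n"
  assumes v: "orthonormal_basis_of W v" and x: "x \<in> W"
  shows "(\<Sum>k\<in>UNIV. (x \<bullet> v k) *\<^sub>R v k) = x"
proof -
  have "x \<in> span (range v)"
    using v x by (simp add: orthonormal_basis_of_def)
  then show ?thesis
  proof (induction rule: span_induct)
    case base
    then show ?case
      by (auto simp: subspace_def inner_left_distrib scaleR_left_distrib sum.distrib
          simp flip: scaleR_scaleR scaleR_sum_right)
  next
    case (step x)
    then obtain j where x: "x = v j" by auto
    have "(v j \<bullet> v k) *\<^sub>R v k = (if k = j then v j else 0)" for k
      using v by (simp add: orthonormal_basis_of_def)
    then show ?case
      by (simp add: x)
  qed
qed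

lemma orthonormal_basis_of_in: "orthonormal_basis_of W v \<Longrightarrow> v j \<in> W"
  by (auto simp: orthonormal_basis_of_def span_base)

lemma orthonormal_basis_of_imp_Gr:
  fixes v :: "'n \<Rightarrow> complex^'n"
  assumes "orthonormal_basis_of W v"
  shows "W \<in> Gr CARD('n)"
proof -
  have v: "v j \<bullet> v k = (if j = k then 1 else 0)" "span (range v) = W" for j k
    using assms by (auto simp: orthonormal_basis_of_def)
  have "inj v"
    by (rule injI) (metis v(1) zero_neq_one)
  moreover have "independent (range v)"
    by (rule pairwise_orthogonal_independent)
      (auto simp: pairwise_def orthogonal_def v, metis inner_zero_left v(1) zero_neq_one)
  ultimately have "dim W = CARD('n)"
    using dim_span_eq_card_independent v(2) card_image by metis
  then show ?thesis
    using v by (auto simp: Gr_def)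
qed

lemma orthonormal_basis_change:
  fixes v w :: "'n \<Rightarrow> complex^'n"
  assumes v: "orthonormal_basis_of W v" and w: "orthonormal_basis_of W w"
  defines "Q \<equiv> (\<chi> j k. w j \<bullet> v k) :: real^'n^'n"
  shows "w j = (\<Sum>k\<in>UNIV. Q $ j $ k *\<^sub>R v k)" "orthogonal_matrix Q"
proof -
  show "w j = (\<Sum>k\<in>UNIV. Q $ j $ k *\<^sub>R v k)"
    using orthonormal_expansion[OF v orthonormal_basis_of_in[OF w]] by (simp add: Q_def)
  have "(Q ** Finite_Cartesian_Product.transpose Q) $ i $ j = mat 1 $ i $ j" for i j
  proof -
    have "(Q ** Finite_Cartesian_Product.transpose Q) $ i $ j = (\<Sum>k\<in>UNIV. (w j \<bullet> v k) * (v k \<bullet> w i))"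
      by (simp add: Q_def matrix_matrix_mult_def Finite_Cartesian_Product.transpose_def
          inner_commute mult.commute)
    also have "\<dots> = (\<Sum>k\<in>UNIV. (w j \<bullet> v k) *\<^sub>R v k) \<bullet> w i"
      by (simp add: inner_sum_left)
    also have "\<dots> = w j \<bullet> w i"
      using orthonormal_expansion[OF v orthonormal_basis_of_in[OF w]] by simp
    finally show ?thesis
      using w by (simp add: orthonormal_basis_of_def mat_def)
  qed
  then have "Q ** Finite_Cartesian_Product.transpose Q = mat 1"
    by (simp add: vec_eq_iff)
  then show "orthogonal_matrix Q"
    by (metis orthogonal_matrix_def matrix_left_right_inverse)
qed


section \<open>Kaehler angles of a canonical basis\<close>

lemma det_of_real: "det (\<chi> i j. complex_of_real (A $ i $ j)) = of_real (det A)"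
  by (simp add: det_def)

text \<open>Only inner products with vectors of \<open>W\<close> enter the matrix in
  \<open>eigenvalues_on\<close>; this replaces the described projection by values of the Kaehler
  form.\<close>

lemma inner_orthogonal_projection:
  assumes w: "orthonormal_basis_of W w" and u: "u \<in> W"
  shows "u \<bullet> orthogonal_projection W x = u \<bullet> x"
proof -
  have W: "subspace W"
    using w by (auto simp: orthonormal_basis_of_def)
  obtain y where y: "y \<in> W" "x - y \<in> W\<^sup>\<bottom>"
    using subspace_sum_orthogonal_comp[OF W] set_plus_elim[of x W "W\<^sup>\<bottom>"]
    by (metis UNIV_I add_diff_cancel_left')
  have "orthogonal_projection W x = y"
    unfolding orthogonal_projection_def
  proof (rule the_equality)
    fix z assume z: "z \<in> W \<and> x - z \<in> W\<^sup>\<bottom>"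
    have "(x - z) - (x - y) \<in> W\<^sup>\<bottom>"
      using y z by (meson subspace_diff subspace_orthogonal_comp)
    moreover have "(x - z) - (x - y) \<in> W"
      using y z W by (auto dest: subspace_diff)
    ultimately show "z = y"
      by (force simp: orthogonal_comp_def orthogonal_def)
  qed (use y in auto)
  moreover have "u \<bullet> (x - y) = 0"
    using y u by (auto simp: orthogonal_comp_def orthogonal_def)
  ultimately show ?thesis
    by (simp add: inner_diff_right)
qed

lemma kahler_form_sum_left: "kahler_form (\<Sum>k\<in>A. f k *\<^sub>R x k) y = (\<Sum>k\<in>A. f k * kahler_form (x k) y)"
  and kahler_form_sum_right: "kahler_form y (\<Sum>k\<in>A. f k *\<^sub>R x k) = (\<Sum>k\<in>A. f k * kahler_form y (x k))"
proof -
  have l: "linear (\<lambda>x. kahler_form x y)" "linear (kahler_form y)"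
    using bilinear_kahler_form by (auto simp: bilinear_def)
  show "kahler_form (\<Sum>k\<in>A. f k *\<^sub>R x k) y = (\<Sum>k\<in>A. f k * kahler_form (x k) y)"
    by (simp add: linear_sum[OF l(1)] linear_scale[OF l(1)])
  show "kahler_form y (\<Sum>k\<in>A. f k *\<^sub>R x k) = (\<Sum>k\<in>A. f k * kahler_form y (x k))"
    by (simp add: linear_sum[OF l(2)] linear_scale[OF l(2)])
qed

lemma kcoeff_mate: "kcoeff \<theta> (mate j) = - kcoeff \<theta> j"
  using even_rk_mate[of j] by (auto simp: kcoeff_def rk_mate_div_2)

lemma sum_lessThan_double:
  "(\<Sum>k<2 * (m::nat). f k) = (\<Sum>j<m. f (2 * j) :: 'a::comm_monoid_add) + (\<Sum>j<m. f (2 * j + 1))"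
  by (induction m) (simp_all add: add_ac)

lemma mset_eq_sum_nth: "mset xs = (\<Sum>j<length xs. {#xs ! j#})"
proof (induction xs rule: rev_induct)
  case (snoc x xs)
  have "(\<Sum>j<length xs. {#(xs @ [x]) ! j#}) = (\<Sum>j<length xs. {#xs ! j#})"
    by (rule sum.cong) (auto simp: nth_append)
  then show ?case using snoc by simp
qed simp

abbreviation angle_eigenvalues :: "real list \<Rightarrow> complex multiset" where
  "angle_eigenvalues \<theta> \<equiv> mset (map (\<lambda>t. \<i> * complex_of_real (cos t)) \<theta>) +
     mset (map (\<lambda>t. - (\<i> * complex_of_real (cos t))) \<theta>)"

text \<open>Splitting by parity of the rank separates the two signs, and the unpaired index supplies
  the extra eigenvalue 0.\<close>

lemma sum_kcoeff:
  assumes "length \<theta> = CARD('n::{finite,linorder}) div 2"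
  shows "(\<Sum>j\<in>(UNIV :: 'n set). {#\<i> * complex_of_real (kcoeff \<theta> j)#}) =
         angle_eigenvalues \<theta> + (if odd CARD('n) then {#0#} else {#})"
proof -
  let ?m = "CARD('n) div 2"
  let ?f = "\<lambda>k. {#\<i> * complex_of_real (kcoeff \<theta> (en k :: 'n))#}"
  have k: "kcoeff \<theta> (en (2 * j) :: 'n) = cos (\<theta> ! j)"
    "kcoeff \<theta> (en (2 * j + 1) :: 'n) = - cos (\<theta> ! j)" if "j < ?m" for j
    using that by (auto simp: kcoeff_def mate_fixed_iff)
  have "(\<Sum>j\<in>(UNIV :: 'n set). {#\<i> * complex_of_real (kcoeff \<theta> j)#}) = (\<Sum>k<CARD('n). ?f k)"
    by (rule sum.reindex_bij_betw[OF bij_betw_en, symmetric])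
  also have "\<dots> = (\<Sum>k<2 * ?m. ?f k) + (if odd CARD('n) then {#0#} else {#})"
  proof (cases "odd CARD('n)")
    case True
    then obtain m where m: "CARD('n) = Suc (2 * m)" by (metis oddE Suc_eq_plus1)
    then have "kcoeff \<theta> (en (2 * m) :: 'n) = 0"
      by (simp add: kcoeff_def mate_fixed_iff)
    then show ?thesis using m by simp
  qed simp
  also have "(\<Sum>k<2 * ?m. ?f k) = angle_eigenvalues \<theta>"
    unfolding mset_eq_sum_nth sum_lessThan_double using k assms by simp
  finally show ?thesis .
qed

text \<open>One similarity handles both the arbitrary basis \<open>v\<close> and the computation of
  the spectrum: \<open>?Q\<close> passes to the canonical basis, \<open>T\<close> makes its blocks
  triangular, and the eigenvalues stand on the diagonal of \<open>D\<close>.\<close>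

lemma eigenvalues_on_canonical:
  fixes w :: "'n::{finite,linorder} \<Rightarrow> (complex, 'n) vec"
  assumes w: "orthonormal_basis_of W w" and can: "canonical_basis \<theta> w"
    and len: "length \<theta> = CARD('n) div 2"
  shows "eigenvalues_on W (\<lambda>x. orthogonal_projection W (Jmul x)) =
         angle_eigenvalues \<theta> + (if odd CARD('n) then {#0#} else {#})"
proof -
  define v where "v = (SOME v. orthonormal_basis_of W v)"
  have v: "orthonormal_basis_of W v"
    unfolding v_def by (rule someI[of _ w]) (rule w)
  \<comment> \<open>The arguments appear exchanged because the form applies \<open>Jmul\<close> to
    its first argument, and the endomorphism acts on the vector of the column index.\<close>
  let ?A = "(\<chi> j k. complex_of_real (kahler_form (v k) (v j))) :: ((complex, 'n) vec, 'n) vec"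
  let ?Q = "(\<chi> j k. complex_of_real (v j \<bullet> w k)) :: ((complex, 'n) vec, 'n) vec"
  let ?B = "(\<chi> j k. complex_of_real (kahler_form (w k) (w j))) :: ((complex, 'n) vec, 'n) vec"
  define D :: "((complex, 'n) vec, 'n) vec" where
    "D = (\<chi> j k. if k = j then \<i> * of_real (kcoeff \<theta> j)
           else if k = mate j \<and> even (rk j) then - of_real (kcoeff \<theta> j) else 0)"
  (* T replaces the first vector of each pair by an eigenvector of the corresponding 2 x 2 block,
     which makes the block triangular. *)
  define T :: "((complex, 'n) vec, 'n) vec" where
    "T = (\<chi> j k. if k = j then 1 else if k = mate j \<and> odd (rk j) then - \<i> else 0)"
  have ev: "eigenvalues_on W (\<lambda>x. orthogonal_projection W (Jmul x)) = proots (characteristic_poly ?A)"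
    unfolding eigenvalues_on_def v_def[symmetric] Let_def
      inner_orthogonal_projection[OF v orthonormal_basis_of_in[OF v]]
    by (simp add: kahler_form_def inner_commute)
  have AQ: "?A ** ?Q = ?Q ** ?B"
  proof -
    have "(\<Sum>l\<in>UNIV. kahler_form (v l) (v j) * (v l \<bullet> w k)) =
          (\<Sum>l\<in>UNIV. (v j \<bullet> w l) * kahler_form (w k) (w l))" for j k
    proof -
      have "(\<Sum>l\<in>UNIV. kahler_form (v l) (v j) * (v l \<bullet> w k)) =
            kahler_form (\<Sum>l\<in>UNIV. (w k \<bullet> v l) *\<^sub>R v l) (v j)"
        by (simp add: kahler_form_sum_left inner_commute mult.commute)
      also have "\<dots> = kahler_form (w k) (\<Sum>l\<in>UNIV. (v j \<bullet> w l) *\<^sub>R w l)"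
        by (simp add: orthonormal_expansion[OF v orthonormal_basis_of_in[OF w]]
            orthonormal_expansion[OF w orthonormal_basis_of_in[OF v]])
      finally show ?thesis
        by (simp add: kahler_form_sum_right)
    qed
    then show ?thesis
      by (simp add: vec_eq_iff matrix_matrix_mult_def flip: of_real_mult of_real_sum)
  qed
  have BT: "?B ** T = T ** D"
  proof -
    have "(?B ** T) $ j $ k = (T ** D) $ j $ k" for j k
    proof -
      have B: "?B $ j $ l = (if l = mate j then - of_real (kcoeff \<theta> j) else 0)" for l
        using can kcoeff_mate[of \<theta> j] by (auto simp: canonical_basis_def)
      have "(?B ** T) $ j $ k = (\<Sum>l\<in>UNIV. if l = mate j then - of_real (kcoeff \<theta> j) * T $ l $ k else 0)"
        unfolding matrix_matrix_mult_def vec_lambda_beta B[unfolded vec_lambda_beta]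
        by (rule sum.cong) auto
      then have l: "(?B ** T) $ j $ k = - of_real (kcoeff \<theta> j) * T $ mate j $ k"
        by simp
      have "(T ** D) $ j $ k = (\<Sum>l\<in>UNIV. (if l = j then D $ l $ k else 0) +
             (if l = mate j then (if odd (rk j) then - \<i> * D $ l $ k else 0) else 0))"
        unfolding matrix_matrix_mult_def vec_lambda_beta
        by (rule sum.cong) (auto simp: T_def mate_neq_if_odd)
      then have r: "(T ** D) $ j $ k = D $ j $ k + (if odd (rk j) then - \<i> * D $ mate j $ k else 0)"
        by (simp add: sum.distrib)
      show ?thesis
      proof (cases "mate j = j")
        case True
        then have "kcoeff \<theta> j = 0" "even (rk j)"
          by (auto simp: kcoeff_def mate_fixed_iff)
        then show ?thesis
          unfolding l r by (simp add: D_def)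
      next
        case False
        then show ?thesis
          unfolding l r using even_rk_mate[OF False] mate_eq_iff[of j k]
          by (auto simp: D_def T_def kcoeff_mate)
      qed
    qed
    then show ?thesis by (simp add: vec_eq_iff)
  qed
  have "?A ** (?Q ** T) = (?Q ** T) ** D"
    unfolding matrix_mul_assoc AQ unfolding matrix_mul_assoc[symmetric] BT ..
  moreover have "det (?Q ** T) \<noteq> 0"
  proof -
    have "det T = 1"
      by (subst det_triangular[OF inj_rk]) (auto simp: T_def rk_mate split: if_splits)
    moreover have "det ?Q = of_real (det (\<chi> j k. v j \<bullet> w k))"
      by (subst det_of_real[symmetric]) simp
    moreover have "det (\<chi> j k. v j \<bullet> w k) \<noteq> 0"
      using det_orthogonal_matrix[OF orthonormal_basis_change(2)[OF w v]] by auto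
    ultimately show ?thesis
      by (simp add: det_mul)
  qed
  ultimately have "characteristic_poly ?A = characteristic_poly D"
    by (rule characteristic_poly_similar)
  moreover have "proots (characteristic_poly D) = (\<Sum>j\<in>(UNIV :: 'n set). {#\<i> * complex_of_real (kcoeff \<theta> j)#})"
    by (subst proots_characteristic_poly_triangular) (auto simp: D_def rk_mate split: if_splits)
  ultimately show ?thesis
    by (simp add: ev sum_kcoeff[OF len])
qed

text \<open>An angle \<open>pi/2\<close> contributes 0 to both lists, so the angles are recovered in
  two steps: those below \<open>pi/2\<close> are the arccosines of the positive imaginary parts,
  with multiplicity, and the length \<open>m\<close> forces how many equal
  \<open>pi/2\<close>.\<close>

lemma angle_eigenvalues_inj:
  assumes \<theta>: "angle_list m \<theta>" and \<eta>: "angle_list m \<eta>"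
    and eq: "angle_eigenvalues \<theta> + E = angle_eigenvalues \<eta> + E"
  shows "\<theta> = \<eta>"
proof -
  have pos: "filter_mset (\<lambda>t. t < pi/2) (mset \<xi>) =
      image_mset (\<lambda>x. arccos (Im x)) (filter_mset (\<lambda>x. Im x > 0) (angle_eigenvalues \<xi>))"
    if "set \<xi> \<subseteq> {0..pi/2}" for \<xi>
    using that
  proof (induction \<xi>)
    case (Cons t \<xi>)
    have "0 \<le> t" "t \<le> pi/2" using Cons.prems by auto
    then have "cos t > 0 \<longleftrightarrow> t < pi/2"
      using cos_gt_zero_pi[of t] pi_gt_zero
      by (metis cos_pi_half less_eq_real_def less_irrefl neg_less_0_iff_less order_less_le_trans
          half_gt_zero)
    moreover have "cos t \<ge> 0" "arccos (cos t) = t"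
      using \<open>0 \<le> t\<close> \<open>t \<le> pi/2\<close> by (auto simp: cos_ge_zero arccos_cos)
    ultimately show ?case
      using Cons by auto
  qed simp
  have split: "mset \<xi> = filter_mset (\<lambda>t. t < pi/2) (mset \<xi>) +
      replicate_mset (m - size (filter_mset (\<lambda>t. t < pi/2) (mset \<xi>))) (pi/2)"
    if "angle_list m \<xi>" for \<xi>
  proof -
    let ?F = "filter_mset (\<lambda>t. \<not> t < pi/2) (mset \<xi>)"
    have part: "mset \<xi> = filter_mset (\<lambda>t. t < pi/2) (mset \<xi>) + ?F"
      by (rule multiset_partition)
    have "size ?F = m - size (filter_mset (\<lambda>t. t < pi/2) (mset \<xi>))"
    proof -
      have "m = size (mset \<xi>)"
        using that by (simp add: angle_list_def)
      also have "\<dots> = size (filter_mset (\<lambda>t. t < pi/2) (mset \<xi>)) + size ?F"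
        by (metis part size_union)
      finally show ?thesis by linarith
    qed
    moreover have "?F = replicate_mset (size ?F) (pi/2)"
    proof -
      have "x = pi/2" if "x \<in># ?F" for x
        using that \<open>angle_list m \<xi>\<close> by (auto simp: angle_list_def dest!: subsetD)
      then have "set_mset ?F \<subseteq> {pi/2}" by blast
      then show ?thesis by (simp add: set_mset_subset_singletonD)
    qed
    ultimately show ?thesis using part by simp
  qed
  have "angle_eigenvalues \<theta> = angle_eigenvalues \<eta>"
    using eq by (rule add_right_imp_eq)
  then have "filter_mset (\<lambda>t. t < pi/2) (mset \<theta>) = filter_mset (\<lambda>t. t < pi/2) (mset \<eta>)"
    using pos[of \<theta>] pos[of \<eta>] \<theta> \<eta> unfolding angle_list_def by metis
  then have "mset \<theta> = mset \<eta>"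
    using split[OF \<theta>] split[OF \<eta>] by metis
  then show ?thesis
    using \<theta> \<eta> by (metis angle_list_def properties_for_sort sorted_sort_id)
qed

lemma kahler_angles_canonical:
  fixes w :: "'n::{finite,linorder} \<Rightarrow> (complex, 'n) vec"
  assumes "orthonormal_basis_of W w" "canonical_basis \<theta> w" and \<theta>: "angle_list (CARD('n) div 2) \<theta>"
  shows "kahler_angles W = \<theta>"
proof -
  have "length \<theta> = CARD('n) div 2"
    using \<theta> by (simp add: angle_list_def)
  note ev = eigenvalues_on_canonical[OF assms(1,2) this]
  show ?thesis
    unfolding kahler_angles_def ev
  proof (rule the_equality)
    fix \<eta> assume "length \<eta> = CARD('n) div 2 \<and> sorted \<eta> \<and> set \<eta> \<subseteq> {0..pi/2} \<and>
      angle_eigenvalues \<theta> + (if odd CARD('n) then {#0#} else {#}) =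
      angle_eigenvalues \<eta> + (if odd CARD('n) then {#0#} else {#})"
    then show "\<eta> = \<theta>"
      using angle_eigenvalues_inj[OF \<theta>, of \<eta>] by (simp add: angle_list_def)
  qed (use \<theta> in \<open>auto simp: angle_list_def\<close>)
qed


section \<open>Exterior powers of the Kaehler form\<close>

text \<open>\<open>det\<close> sums over permutations of the index type, the exterior power over
  those of an initial segment; conjugation by the enumeration preserves signs and matches the
  sums.\<close>

lemma kahler_form_power_UNIV:
  fixes w :: "'n::{finite,linorder} \<Rightarrow> (complex, 'n) vec"
  assumes n: "CARD('n) = 2 * m"
  shows "kahler_form_power m (\<lambda>k. w (en k)) =
    (\<Sum>p | p permutes (UNIV :: 'n set). of_int (sign p) *
       (\<Prod>k<m. kahler_form (w (p (en (2 * k)))) (w (p (en (2 * k + 1)))))) / 2 ^ m"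
proof -
  let ?A = "{..<2 * m}"
  have bij: "bij_betw (en :: nat \<Rightarrow> 'n) ?A UNIV"
    using bij_betw_en[where 'n = 'n] by (simp add: n)
  have inj: "inj_on (en :: nat \<Rightarrow> 'n) ?A"
    using bij by (rule bij_betw_imp_inj_on)
  have bij': "bij_betw (rk :: 'n \<Rightarrow> nat) UNIV ?A"
    by (rule bij_betw_byWitness[where f' = en]) (use n rk_less[where 'n = 'n] in auto)
  have "(\<Sum>p | p permutes ?A. of_int (sign p) *
          (\<Prod>k<m. kahler_form (w (en (p (2 * k)))) (w (en (p (2 * k + 1)))))) =
    (\<Sum>p | p permutes (UNIV :: 'n set). of_int (sign p) *
       (\<Prod>k<m. kahler_form (w (p (en (2 * k)))) (w (p (en (2 * k + 1))))))"
  proof (rule sum.reindex_bij_witness[of _ "map_permutation UNIV rk" "map_permutation ?A en"])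
    fix p assume "p \<in> {p. p permutes ?A}"
    then have p: "p permutes ?A" by simp
    show "map_permutation UNIV rk (map_permutation ?A (en :: nat \<Rightarrow> 'n) p) = p"
      by (rule map_permutation_compose_inv[OF bij p]) (simp add: n)
    show "map_permutation ?A (en :: nat \<Rightarrow> 'n) p \<in> {p. p permutes UNIV}"
      using map_permutation_permutes[OF bij p] by simp
    have "map_permutation ?A en p (en k) = (en (p k) :: 'n)" if "k < 2 * m" for k
      using map_permutation_apply[OF inj] that by simp
    then show "of_int (sign (map_permutation ?A (en :: nat \<Rightarrow> 'n) p)) *
        (\<Prod>k<m. kahler_form (w (map_permutation ?A en p (en (2 * k))))
                        (w (map_permutation ?A en p (en (2 * k + 1))))) =
        of_int (sign p) * (\<Prod>k<m. kahler_form (w (en (p (2 * k)))) (w (en (p (2 * k + 1)))))"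
      by (simp add: sign_map_permutation[OF inj p])
  next
    fix p assume "p \<in> {p. p permutes (UNIV :: 'n set)}"
    then have p: "p permutes (UNIV :: 'n set)" by simp
    show "map_permutation ?A en (map_permutation UNIV rk p) = p"
      by (rule map_permutation_compose_inv[OF bij' p]) simp
    show "map_permutation UNIV rk p \<in> {p. p permutes ?A}"
      using map_permutation_permutes[OF bij' p] by simp
  qed
  then show ?thesis
    by (simp add: kahler_form_power_def)
qed

lemma prod_lessThan_double:
  "(\<Prod>k<2 * (m::nat). f k) = (\<Prod>j<m. f (2 * j) * f (2 * j + 1) :: 'a::comm_monoid_mult)"
  by (induction m) (simp_all add: mult_ac)

text \<open>A form of top degree scales by the determinant. Expanding every factor over a choice
  \<open>g\<close> of its two summation indices turns the sum over permutations into a determinant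
  of selected columns of \<open>Q\<close>, which is \<open>det Q\<close> times a factor free of
  \<open>Q\<close>.\<close>

lemma kahler_form_power_change:
  fixes v :: "'n::{finite,linorder} \<Rightarrow> (complex, 'n) vec"
  assumes n: "CARD('n) = 2 * m"
  shows "kahler_form_power m (\<lambda>k. \<Sum>l\<in>UNIV. Q $ en k $ l *\<^sub>R v l) =
         det Q * kahler_form_power m (\<lambda>k. v (en k))"
proof -
  \<comment> \<open>\<open>a g\<close> flattens the chosen index pairs into one selection of
    columns, in rank order.\<close>
  define a :: "(nat \<Rightarrow> 'n \<times> 'n) \<Rightarrow> 'n \<Rightarrow> 'n" where
    "a g j = (if even (rk j) then fst else snd) (g (rk j div 2))" for g j
  let ?G = "PiE {..<m} (\<lambda>_. UNIV :: ('n \<times> 'n) set)"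
  let ?om = "\<lambda>g. \<Prod>k<m. kahler_form (v (fst (g k))) (v (snd (g k)))"
  define C where "C = (\<Sum>g\<in>?G. det (\<chi> i. mat 1 $ a g i :: ((real, 'n) vec, 'n) vec) * ?om g) / 2 ^ m"
  (* C does not depend on Q, so that it can be read off from Q = 1. *)
  have *: "kahler_form_power m (\<lambda>k. \<Sum>l\<in>UNIV. Q $ en k $ l *\<^sub>R v l) = det Q * C" for Q
  proof -
    let ?w = "\<lambda>j. \<Sum>l\<in>UNIV. Q $ j $ l *\<^sub>R v l"
    have om: "kahler_form (?w i) (?w j) =
        (\<Sum>y\<in>UNIV. Q $ i $ fst y * Q $ j $ snd y * kahler_form (v (fst y)) (v (snd y)))" for i j
    proof -
      have "kahler_form (?w i) (?w j) = (\<Sum>k\<in>UNIV. Q $ i $ k * kahler_form (v k) (?w j))"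
        by (rule kahler_form_sum_left)
      then show ?thesis
        by (simp add: kahler_form_sum_right sum_distrib_left sum.cartesian_product
            case_prod_unfold mult.assoc)
    qed
    have prd: "(\<Prod>k<m. kahler_form (?w (p (en (2 * k)))) (?w (p (en (2 * k + 1))))) =
        (\<Sum>g\<in>?G. (\<Prod>j\<in>UNIV. Q $ p j $ a g j) * ?om g)" for p
    proof -
      have "(\<Prod>k<m. Q $ p (en (2 * k)) $ fst (g k) * Q $ p (en (2 * k + 1)) $ snd (g k)) =
            (\<Prod>j\<in>UNIV. Q $ p j $ a g j)" for g
      proof -
        have "(\<Prod>j\<in>UNIV. Q $ p j $ a g j) = (\<Prod>k<2 * m. Q $ p (en k) $ a g (en k))"
          by (subst prod.reindex_bij_betw[OF bij_betw_en, symmetric]) (simp add: n)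
        also have "\<dots> = (\<Prod>k<m. Q $ p (en (2 * k)) $ fst (g k) * Q $ p (en (2 * k + 1)) $ snd (g k))"
          unfolding prod_lessThan_double by (rule prod.cong) (auto simp: a_def n)
        finally show ?thesis ..
      qed
      then show ?thesis
        unfolding om by (subst prod_sum_PiE) (simp_all add: prod.distrib)
    qed
    have dt: "(\<Sum>p | p permutes UNIV. of_int (sign p) * (\<Prod>j\<in>UNIV. Q $ p j $ a g j)) =
        det Q * det (\<chi> i. mat 1 $ a g i :: ((real, 'n) vec, 'n) vec)" for g
    proof -
      have "(\<Sum>p | p permutes UNIV. of_int (sign p) * (\<Prod>j\<in>UNIV. Q $ p j $ a g j)) =
          det (\<chi> i. Finite_Cartesian_Product.transpose Q $ a g i)"
        by (simp add: det_def Finite_Cartesian_Product.transpose_def)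
      also have "(\<chi> i. Finite_Cartesian_Product.transpose Q $ a g i) =
          (\<chi> i. mat 1 $ a g i) ** Finite_Cartesian_Product.transpose Q"
        by (simp add: vec_eq_iff matrix_matrix_mult_def mat_def if_distrib if_distribR cong: if_cong)
      finally show ?thesis
        by (simp add: det_mul)
    qed
    have "(\<Sum>p | p permutes UNIV. of_int (sign p) *
            (\<Prod>k<m. kahler_form (?w (p (en (2 * k)))) (?w (p (en (2 * k + 1)))))) =
          (\<Sum>g\<in>?G. (\<Sum>p | p permutes UNIV. of_int (sign p) * (\<Prod>j\<in>UNIV. Q $ p j $ a g j)) * ?om g)"
      unfolding prd sum_distrib_left sum_distrib_right by (subst sum.swap) (simp add: mult_ac)
    also have "\<dots> = det Q * (\<Sum>g\<in>?G. det (\<chi> i. mat 1 $ a g i :: ((real, 'n) vec, 'n) vec) * ?om g)"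
      unfolding dt by (simp add: sum_distrib_left mult_ac)
    finally show ?thesis
      unfolding kahler_form_power_UNIV[OF n, of ?w] C_def by simp
  qed
  have "(\<Sum>l\<in>UNIV. (mat 1 :: ((real, 'n) vec, 'n) vec) $ j $ l *\<^sub>R v l) = v j" for j
  proof -
    have "(mat 1 :: ((real, 'n) vec, 'n) vec) $ j $ l *\<^sub>R v l = (if l = j then v j else 0)" for l
      by (simp add: mat_def)
    then show ?thesis by simp
  qed
  then have "kahler_form_power m (\<lambda>k. v (en k)) = C"
    using *[of "mat 1"] by simp
  then show ?thesis
    using * by simp
qed

text \<open>In a nonzero term the permutation maps pairs onto pairs. Moving the pair that lands in
  the last block to the last position, and then restoring its inner order, leaves the term
  unchanged; a permutation fixing the last pair reduces to \<open>m\<close> blocks.\<close>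

lemma block_form_term_nonneg:
  fixes f :: "nat \<Rightarrow> nat \<Rightarrow> real"
  assumes skew: "\<And>i j. f j i = - f i j"
    and pos: "\<And>k. k < m \<Longrightarrow> f (2 * k) (2 * k + 1) \<ge> 0"
    and block: "\<And>i j. i < 2 * m \<Longrightarrow> j < 2 * m \<Longrightarrow> f i j \<noteq> 0 \<Longrightarrow> i div 2 = j div 2"
    and p: "p permutes {..<2 * m}"
  shows "0 \<le> of_int (sign p) * (\<Prod>k<m. f (p (2 * k)) (p (2 * k + 1)))"
  using pos block p
proof (induction m arbitrary: p)
  case (Suc m)
  let ?N = "{..<2 * Suc m}"
  let ?u = "2 * m" and ?v = "2 * m + 1"
  define t where "t M p = of_int (sign p) * (\<Prod>k<M. f (p (2 * k)) (p (2 * k + 1)))"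
    for M :: nat and p
  have perm: "permutation q" if "q permutes ?N" for q
    using that by (auto simp: permutation_permutes)
  show ?case
  proof (cases "\<forall>k<Suc m. f (p (2 * k)) (p (2 * k + 1)) \<noteq> 0")
    case False
    then have "(\<Prod>k<Suc m. f (p (2 * k)) (p (2 * k + 1))) = 0"
      by (intro prod_zero) auto
    then show ?thesis by (simp only: mult_zero_right order.refl)
  next
    case True
    have p: "p permutes ?N" by fact
    have "?u \<in> p ` ?N"
      using permutes_image[OF p] by simp
    then obtain i where i: "i < 2 * Suc m" "p i = ?u"
      unfolding image_iff by auto
    define k where "k = i div 2"
    have k: "k < Suc m" using i by (auto simp: k_def)
    have pN: "p x < 2 * Suc m" if "x < 2 * Suc m" for x
      using permutes_in_image[OF p, of x] that by simp
    have "p (2 * k) div 2 = p (2 * k + 1) div 2"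
      using Suc.prems(2)[OF pN pN, of "2 * k" "2 * k + 1"] True k by auto
    moreover have "i = 2 * k \<or> i = 2 * k + 1"
      by (auto simp: k_def)
    ultimately have pk: "p (2 * k) div 2 = m" "p (2 * k + 1) div 2 = m"
      using i by auto
    \<comment> \<open>Exchanges the pairs \<open>k\<close> and \<open>m\<close> as wholes: two
      transpositions, or the identity if \<open>k = m\<close>, so an even permutation that only
      reorders the factors.\<close>
    define \<tau> where "\<tau> = Transposition.transpose (2 * k) ?u \<circ> Transposition.transpose (2 * k + 1) ?v"
    have \<tau>: "\<tau> permutes ?N"
      unfolding \<tau>_def using k by (intro permutes_compose permutes_swap_id) auto
    have \<tau>_eq: "\<tau> (2 * x) = 2 * Transposition.transpose k m x"
      "\<tau> (2 * x + 1) = 2 * Transposition.transpose k m x + 1" for x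
    proof -
      have "2 * a \<noteq> 2 * b + (1::nat)" for a b by presburger
      then show "\<tau> (2 * x) = 2 * Transposition.transpose k m x"
        "\<tau> (2 * x + 1) = 2 * Transposition.transpose k m x + 1"
        by (auto simp: \<tau>_def Transposition.transpose_def)
    qed
    have "sign \<tau> = 1"
      unfolding \<tau>_def by (simp add: sign_compose permutation_swap_id sign_swap_id del: comp_apply)
    define p1 where "p1 = p \<circ> \<tau>"
    have p1: "p1 permutes ?N"
      unfolding p1_def using \<tau> p by (rule permutes_compose)
    have t1: "t (Suc m) p1 = t (Suc m) p"
    proof -
      have "sign p1 = sign p"
        unfolding p1_def using \<open>sign \<tau> = 1\<close> perm[OF p] perm[OF \<tau>] by (simp add: sign_compose)
      moreover have "(\<Prod>x<Suc m. f (p1 (2 * x)) (p1 (2 * x + 1))) =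
          (\<Prod>x<Suc m. f (p (2 * x)) (p (2 * x + 1)))"
      proof -
        have "Transposition.transpose k m permutes {..<Suc m}"
          using k by (intro permutes_swap_id) auto
        from prod.permute[OF this, of "\<lambda>x. f (p (2 * x)) (p (2 * x + 1))"]
        show ?thesis
          unfolding p1_def comp_def \<tau>_eq ..
      qed
      ultimately show ?thesis by (simp add: t_def)
    qed
    have p1m: "p1 ?u div 2 = m" "p1 ?v div 2 = m"
      using pk \<tau>_eq[of m] by (simp_all add: p1_def)
    have p1_inj: "p1 ?u \<noteq> p1 ?v"
      using permutes_inj[OF p1] by (simp add: inj_eq)
    have fixed: "0 \<le> t (Suc m) q" if q: "q permutes ?N" "q ?u = ?u" "q ?v = ?v" for q
    proof -
      have "q x = x" if "x \<notin> {..<2 * m}" for x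
      proof (cases "x = ?u \<or> x = ?v")
        case False
        then have "x \<notin> ?N" using that by auto
        then show ?thesis using q(1) by (simp add: permutes_not_in)
      qed (use q in auto)
      then have "q permutes {..<2 * m}"
        using q(1) by (auto simp: permutes_def)
      then have "0 \<le> t m q"
        unfolding t_def using Suc.prems by (intro Suc.IH) auto
      moreover have "t (Suc m) q = t m q * f ?u ?v"
        using q by (simp add: t_def)
      ultimately show ?thesis
        using Suc.prems(1)[of m] by simp
    qed
    have "0 \<le> t (Suc m) p1"
    proof (cases "p1 ?u = ?u")
      case True
      then have "p1 ?v = ?v"
        using p1m p1_inj by presburger
      then show ?thesis using fixed p1 True by blast
    next
      case False
      have "x = ?u \<or> x = ?v" if "x div 2 = m" for x
        using that by presburger
      then have swap: "p1 ?u = ?v" "p1 ?v = ?u"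
        using False p1m p1_inj by metis+
      \<comment> \<open>The extra transposition changes the sign of the permutation and, by
        skewness, that of the last factor.\<close>
      define p2 where "p2 = p1 \<circ> Transposition.transpose ?u ?v"
      have "Transposition.transpose ?u ?v permutes ?N"
        by (intro permutes_swap_id) auto
      then have p2: "p2 permutes ?N"
        unfolding p2_def using p1 by (rule permutes_compose)
      have "p2 ?u = ?u" "p2 ?v = ?v"
        using swap by (simp_all add: p2_def)
      then have "0 \<le> t (Suc m) p2"
        using fixed p2 by blast
      moreover have "sign p2 = - sign p1"
        unfolding p2_def using perm[OF p1]
        by (simp add: sign_compose permutation_swap_id sign_swap_id)
      moreover have "p2 x = p1 x" if "x < 2 * m" for x
        using that by (simp add: p2_def Transposition.transpose_def)
      moreover have "f (p2 ?u) (p2 ?v) = - f (p1 ?u) (p1 ?v)"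
        using skew[of "p1 ?u" "p1 ?v"] by (simp add: p2_def)
      ultimately show ?thesis
        by (simp add: t_def)
    qed
    then show ?thesis
      using t1 by (simp add: t_def)
  qed
qed simp

text \<open>The identity permutation contributes the product of the cosines, and no term is
  negative.\<close>

lemma kahler_form_power_canonical_pos:
  fixes w :: "'n::{finite,linorder} \<Rightarrow> (complex, 'n) vec"
  assumes n: "CARD('n) = 2 * m" and w: "canonical_basis \<theta> w"
    and pos: "\<And>k. k < m \<Longrightarrow> cos (\<theta> ! k) > 0"
  shows "kahler_form_power m (\<lambda>k. w (en k)) > 0"
proof -
  let ?f = "\<lambda>i j. kahler_form (w (en i)) (w (en j))"
  let ?t = "\<lambda>p. of_int (sign p) * (\<Prod>k<m. ?f (p (2 * k)) (p (2 * k + 1)))"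
  have f: "?f (2 * k) (2 * k + 1) = cos (\<theta> ! k)" if "k < m" for k
  proof -
    have "mate (en (2 * k) :: 'n) = en (2 * k + 1)" "mate (en (2 * k) :: 'n) \<noteq> en (2 * k)"
      using that n by (auto simp: mate_fixed_iff) (simp add: mate_def)
    then show ?thesis
      using w that n by (simp add: canonical_basis_def kcoeff_def)
  qed
  have block: "i div 2 = j div 2" if "i < 2 * m" "j < 2 * m" "?f i j \<noteq> 0" for i j
  proof -
    have "en j = mate (en i :: 'n)"
      using w that(3) by (auto simp: canonical_basis_def split: if_splits)
    then show ?thesis
      using rk_mate_div_2[of "en i :: 'n"] that n by (metis rk_en)
  qed
  have nonneg: "0 \<le> ?t p" if "p permutes {..<2 * m}" for p
    by (rule block_form_term_nonneg[OF kahler_form_commute _ block that])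
      (use f pos in \<open>auto simp: less_imp_le\<close>)
  have "0 < ?t id"
    using f pos by (auto intro!: prod_pos)
  also have "?t id = (\<Sum>p\<in>{id}. ?t p)" by simp
  also have "\<dots> \<le> (\<Sum>p | p permutes {..<2 * m}. ?t p)"
    by (rule sum_mono2) (use nonneg in \<open>auto simp: finite_permutations permutes_id\<close>)
  finally show ?thesis
    by (simp add: kahler_form_power_def)
qed


section \<open>Existence of canonical bases\<close>

lemma kahler_form_self [simp]: "kahler_form x x = 0"
  using kahler_form_commute[of x x] by simp

lemma norm_Jmul [simp]: "norm (Jmul x) = norm x"
  by (simp add: Jmul_def norm_vec_def norm_mult)

lemma kahler_form_le: "kahler_form x y \<le> norm x * norm y"
  unfolding kahler_form_def using norm_cauchy_schwarz[of "Jmul x" y] by simp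

lemma kahler_form_scaleR_right: "kahler_form x (r *\<^sub>R y) = r * kahler_form x y"
  and kahler_form_minus_right: "kahler_form x (- y) = - kahler_form x y"
  by (simp_all add: kahler_form_def)

(* At a maximum of the form over the unit sphere, the vector of W representing kahler_form x
   has norm kahler_form x y, hence is a multiple of y. *)
lemma kahler_form_at_maximum:
  assumes W: "subspace W" and x: "x \<in> W" and y: "y \<in> W" "norm y = 1"
    and max: "\<And>v. v \<in> W \<Longrightarrow> norm v = 1 \<Longrightarrow> kahler_form x v \<le> kahler_form x y"
    and nonneg: "0 \<le> kahler_form x y"
    and z: "z \<in> W"
  shows "kahler_form x z = kahler_form x y * (y \<bullet> z)"
proof -
  let ?c = "kahler_form x y"
  obtain r where r: "r \<in> W" "Jmul x - r \<in> W\<^sup>\<bottom>"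
    using subspace_sum_orthogonal_comp[OF W] set_plus_elim[of "Jmul x" W "W\<^sup>\<bottom>"]
    by (metis UNIV_I add_diff_cancel_left')
  have rep: "kahler_form x v = r \<bullet> v" if "v \<in> W" for v
  proof -
    have "v \<bullet> (Jmul x - r) = 0"
      using r that by (auto simp: orthogonal_comp_def orthogonal_def)
    then show ?thesis
      by (simp add: kahler_form_def inner_diff_right inner_commute)
  qed
  have "norm r \<le> ?c"
  proof (cases "r = 0")
    case False
    have "kahler_form x (inverse (norm r) *\<^sub>R r) \<le> ?c"
      using r W False by (intro max subspace_scale) auto
    moreover have "kahler_form x (inverse (norm r) *\<^sub>R r) = norm r"
      using False rep[OF r(1)]
      by (simp add: kahler_form_scaleR_right dot_square_norm power2_eq_square)
    ultimately show ?thesis by simp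
  qed (use nonneg in simp)
  then have "r \<bullet> r \<le> ?c * ?c"
    unfolding dot_square_norm power2_eq_square by (intro mult_mono nonneg) auto
  moreover have "(r - ?c *\<^sub>R y) \<bullet> (r - ?c *\<^sub>R y) = r \<bullet> r - 2 * ?c * (r \<bullet> y) + ?c * ?c * (y \<bullet> y)"
    by (simp add: inner_diff_left inner_diff_right inner_commute algebra_simps)
  moreover have "r \<bullet> y = ?c" "y \<bullet> y = 1"
    using rep[OF y(1)] y(2) by (simp_all add: dot_square_norm)
  ultimately have "(r - ?c *\<^sub>R y) \<bullet> (r - ?c *\<^sub>R y) \<le> 0"
    by simp
  then have "r = ?c *\<^sub>R y"
    by (metis eq_iff_diff_eq_0 inner_eq_zero_iff inner_ge_zero order_antisym)
  then show ?thesis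
    using rep[OF z] by simp
qed

text \<open>Compactness provides a maximum. If it is 0, skewness makes any orthonormal pair attain
  it; if it is positive, orthogonality follows by inserting \<open>x0\<close> into the formula valid
  at a maximum. The final clause is kept for ordering the angles.\<close>

lemma exists_maximal_pair:
  fixes W :: "(complex^'n) set"
  assumes W: "subspace W" and dim: "dim W \<ge> 2"
  obtains x y where "x \<in> W" "y \<in> W" "norm x = 1" "norm y = 1" "x \<bullet> y = 0"
    "kahler_form x y \<ge> 0"
    "\<And>z. z \<in> W \<Longrightarrow> kahler_form x z = kahler_form x y * (y \<bullet> z)"
    "\<And>z. z \<in> W \<Longrightarrow> kahler_form y z = - (kahler_form x y * (x \<bullet> z))"
    "\<And>u v. u \<in> W \<Longrightarrow> v \<in> W \<Longrightarrow> norm u = 1 \<Longrightarrow> norm v = 1 \<Longrightarrow> kahler_form u v \<le> kahler_form x y"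
proof -
  let ?S = "sphere 0 1 \<inter> W"
  obtain B where B: "B \<subseteq> W" "pairwise orthogonal B" "\<And>x. x \<in> B \<Longrightarrow> norm x = 1" "card B = dim W"
    using orthonormal_basis_subspace[OF W] by metis
  then have "card B \<ge> 2" using dim by simp
  then obtain p q where "p \<in> B" "q \<in> B" "p \<noteq> q"
    by (metis One_nat_def card_le_Suc0_iff_eq card.infinite not_less_eq_eq numeral_2_eq_2 zero_le)
  then have pq: "p \<in> W" "q \<in> W" "norm p = 1" "norm q = 1" "p \<bullet> q = 0"
    using B by (auto simp: pairwise_def orthogonal_def)
  have "compact (?S \<times> ?S)"
    by (intro compact_Times compact_Int_closed closed_subspace W) auto
  moreover have "?S \<times> ?S \<noteq> {}"
    using pq by auto
  moreover have "continuous_on (?S \<times> ?S) (\<lambda>(x, y). kahler_form x y)"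
    unfolding kahler_form_def Jmul_def inner_vec_def case_prod_unfold vector_smult_component
    by (intro continuous_intros)
  ultimately have "\<exists>s\<in>?S \<times> ?S. \<forall>t\<in>?S \<times> ?S.
      (\<lambda>(x, y). kahler_form x y) t \<le> (\<lambda>(x, y). kahler_form x y) s"
    by (rule continuous_attains_sup)
  then obtain s where s: "s \<in> ?S \<times> ?S"
    "\<forall>t\<in>?S \<times> ?S. (\<lambda>(x, y). kahler_form x y) t \<le> (\<lambda>(x, y). kahler_form x y) s" ..
  obtain x0 y0 where s_eq: "s = (x0, y0)" by fastforce
  have xy0: "x0 \<in> W" "y0 \<in> W" "norm x0 = 1" "norm y0 = 1"
    using s s_eq by auto
  have max0: "kahler_form u v \<le> kahler_form x0 y0"
    if "u \<in> W" "v \<in> W" "norm u = 1" "norm v = 1" for u v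
    using s s_eq that by auto
  have nonneg: "kahler_form x0 y0 \<ge> 0"
    using max0[of x0 x0] xy0 by simp
  have "\<exists>x y. x \<in> W \<and> y \<in> W \<and> norm x = 1 \<and> norm y = 1 \<and> x \<bullet> y = 0 \<and>
          kahler_form x y = kahler_form x0 y0"
  proof (cases "kahler_form x0 y0 = 0")
    case True
    then have "kahler_form p q \<le> 0" "kahler_form q p \<le> 0"
      using max0 pq by metis+
    then show ?thesis
      using True pq kahler_form_commute[of q p] by (intro exI[of _ p] exI[of _ q]) simp
  next
    case False
    have "kahler_form x0 x0 = kahler_form x0 y0 * (y0 \<bullet> x0)"
      by (rule kahler_form_at_maximum[OF W]) (use xy0 max0 nonneg in auto)
    then have "x0 \<bullet> y0 = 0"
      using False by (simp add: inner_commute)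
    then show ?thesis using xy0 by blast
  qed
  then obtain x y where xy: "x \<in> W" "y \<in> W" "norm x = 1" "norm y = 1" "x \<bullet> y = 0"
    and eq: "kahler_form x y = kahler_form x0 y0" by blast
  \<comment> \<open>The pair \<open>y\<close>, \<open>- x\<close> attains the same value, so the
    formula at a maximum also describes the form against \<open>y\<close>.\<close>
  have yx: "kahler_form y (- x) = kahler_form x y"
    using kahler_form_commute[of x y] by (simp add: kahler_form_minus_right)
  show ?thesis
  proof
    show "kahler_form x z = kahler_form x y * (y \<bullet> z)" if "z \<in> W" for z
      by (rule kahler_form_at_maximum[OF W]) (use xy eq max0 nonneg that in auto)
    have "kahler_form y z = kahler_form y (- x) * (- x \<bullet> z)" if "z \<in> W" for z
      by (rule kahler_form_at_maximum[OF W])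
        (use xy eq max0 nonneg that yx subspace_neg[OF W] in auto)
    then show "kahler_form y z = - (kahler_form x y * (x \<bullet> z))" if "z \<in> W" for z
      using that yx by simp
  qed (use xy eq nonneg max0 in auto)
qed

text \<open>Natural indices and free dimension suit a recursion that drops two dimensions at a time.
  The values on pairs become the cosines, hence they decrease while the angles increase.\<close>

definition canonical_sequence :: "nat \<Rightarrow> (complex^'n) set \<Rightarrow> (nat \<Rightarrow> complex^'n) \<Rightarrow> bool" where
  "canonical_sequence d W v \<longleftrightarrow>
    (\<forall>i<d. v i \<in> W) \<and>
    (\<forall>i<d. \<forall>j<d. v i \<bullet> v j = (if i = j then 1 else 0)) \<and>
    (\<forall>i<d. \<forall>j<d. i div 2 \<noteq> j div 2 \<longrightarrow> kahler_form (v i) (v j) = 0) \<and>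
    (\<forall>a. 2 * a + 1 < d \<longrightarrow> 0 \<le> kahler_form (v (2 * a)) (v (2 * a + 1))) \<and>
    (\<forall>a b. a \<le> b \<longrightarrow> 2 * b + 1 < d \<longrightarrow>
       kahler_form (v (2 * b)) (v (2 * b + 1)) \<le> kahler_form (v (2 * a)) (v (2 * a + 1)))"

lemma canonical_sequenceD:
  assumes "canonical_sequence d W v"
  shows "i < d \<Longrightarrow> v i \<in> W"
    and "i < d \<Longrightarrow> j < d \<Longrightarrow> v i \<bullet> v j = (if i = j then 1 else 0)"
    and "i < d \<Longrightarrow> j < d \<Longrightarrow> i div 2 \<noteq> j div 2 \<Longrightarrow> kahler_form (v i) (v j) = 0"
    and "2 * a + 1 < d \<Longrightarrow> 0 \<le> kahler_form (v (2 * a)) (v (2 * a + 1))"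
    and "a \<le> b \<Longrightarrow> 2 * b + 1 < d \<Longrightarrow>
       kahler_form (v (2 * b)) (v (2 * b + 1)) \<le> kahler_form (v (2 * a)) (v (2 * a + 1))"
  using assms unfolding canonical_sequence_def by simp_all

text \<open>By the formulas at the maximum, vectors of \<open>W\<close> orthogonal to a maximal pair
  are also orthogonal to it for the Kaehler form, so the two parts do not interact. A maximum over a
  smaller subspace cannot be larger, which gives the order.\<close>

lemma exists_canonical_sequence:
  fixes W :: "(complex^'n) set"
  assumes "subspace W" "dim W = d"
  shows "\<exists>v. canonical_sequence d W v"
  using assms
proof (induction d arbitrary: W rule: less_induct)
  case (less d)
  consider "d = 0" | "d = 1" | "d \<ge> 2" by linarith
  then show ?case
  proof cases
    case 1
    then show ?thesis by (simp add: canonical_sequence_def)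
  next
    case 2
    obtain B where B: "B \<subseteq> W" "\<And>x. x \<in> B \<Longrightarrow> norm x = 1" "card B = dim W"
      using orthonormal_basis_subspace[OF less.prems(1)] by metis
    then obtain b where "b \<in> B"
      using less.prems 2 by (metis card.empty ex_in_conv zero_neq_one)
    then show ?thesis
      using B 2 by (intro exI[of _ "\<lambda>_. b"]) (auto simp: canonical_sequence_def dot_square_norm)
  next
    case 3
    note W = less.prems(1)
    obtain x y where xy: "x \<in> W" "y \<in> W" "norm x = 1" "norm y = 1" "x \<bullet> y = 0"
      and nonneg: "kahler_form x y \<ge> 0"
      and fx: "\<And>z. z \<in> W \<Longrightarrow> kahler_form x z = kahler_form x y * (y \<bullet> z)"
      and fy: "\<And>z. z \<in> W \<Longrightarrow> kahler_form y z = - (kahler_form x y * (x \<bullet> z))"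
      and max: "\<And>u v. u \<in> W \<Longrightarrow> v \<in> W \<Longrightarrow> norm u = 1 \<Longrightarrow> norm v = 1 \<Longrightarrow> kahler_form u v \<le> kahler_form x y"
      using exists_maximal_pair[OF W] less.prems(2) 3 by metis
    have xx: "x \<bullet> x = 1" "y \<bullet> y = 1" "y \<bullet> x = 0"
      using xy by (simp_all add: dot_square_norm inner_commute)
    let ?A = "span {x, y}"
    define W' where "W' = {z \<in> W. \<forall>u\<in>?A. orthogonal u z}"
    have W'_D: "z \<in> W" "x \<bullet> z = 0" "y \<bullet> z = 0" if "z \<in> W'" for z
      using that span_base[of x "{x, y}"] span_base[of y "{x, y}"]
      by (auto simp: W'_def orthogonal_def)
    have "subspace W'"
      unfolding W'_def using W
      by (auto simp: subspace_def orthogonal_def inner_add_right)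
    moreover have "dim W' = d - 2"
    proof -
      have "x \<noteq> y" using xx xy by auto
      have "independent {x, y}"
        by (rule pairwise_orthogonal_independent)
          (use xx xy in \<open>auto simp: pairwise_def orthogonal_def\<close>)
      then have "dim ?A = 2"
        using \<open>x \<noteq> y\<close> dim_span_eq_card_independent[of "{x, y}"] by simp
      moreover have "dim W' + dim ?A = dim W"
        unfolding W'_def using xy W
        by (intro dim_subspace_orthogonal_to_vectors span_minimal) auto
      ultimately show ?thesis
        using less.prems(2) by simp
    qed
    moreover have "d - 2 < d" using 3 by simp
    ultimately obtain v where "canonical_sequence (d - 2) W' v"
      using less.IH[of "d - 2" W'] by metis
    note v = canonical_sequenceD[OF this]
    have vW: "v i \<in> W" "x \<bullet> v i = 0" "y \<bullet> v i = 0" "v i \<bullet> x = 0" "v i \<bullet> y = 0" "norm (v i) = 1"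
      if "i < d - 2" for i
      using W'_D[OF v(1)[OF that]] v(2)[OF that that]
      by (simp_all add: inner_commute norm_eq_sqrt_inner)
    have fv: "kahler_form x (v i) = 0" "kahler_form y (v i) = 0"
      "kahler_form (v i) x = 0" "kahler_form (v i) y = 0" if "i < d - 2" for i
      using fx[OF vW(1)[OF that]] fy[OF vW(1)[OF that]] vW[OF that]
        kahler_form_commute[of "v i" x] kahler_form_commute[of "v i" y] by simp_all
    \<comment> \<open>Prepending two vectors shifts indices by two, so pairs remain pairs.\<close>
    define u where "u i = (case i of 0 \<Rightarrow> x | Suc 0 \<Rightarrow> y | Suc (Suc k) \<Rightarrow> v k)" for i
    have u: "u 0 = x" "u (Suc 0) = y" "u (Suc (Suc k)) = v k" for k
      by (simp_all add: u_def)
    have cases2: "P i" if "P 0" "P (Suc 0)" "\<And>k. k < d - 2 \<Longrightarrow> P (Suc (Suc k))" "i < d"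
      for P :: "nat \<Rightarrow> bool" and i
    proof -
      consider "i = 0" | "i = Suc 0" | k where "i = Suc (Suc k)"
        by (metis not0_implies_Suc)
      then show ?thesis
        using that by cases auto
    qed
    have "u i \<in> W" if "i < d" for i
      by (rule cases2[OF _ _ _ that]) (use xy vW in \<open>auto simp: u\<close>)
    moreover have "u i \<bullet> u j = (if i = j then 1 else 0)" if "i < d" "j < d" for i j
      by (rule cases2[OF _ _ _ that(1)]; rule cases2[OF _ _ _ that(2)])
        (use xx xy vW v(2) in \<open>auto simp: u\<close>)
    moreover have "kahler_form (u i) (u j) = 0" if "i < d" "j < d" "i div 2 \<noteq> j div 2" for i j
    proof -
      have "i div 2 \<noteq> j div 2 \<longrightarrow> kahler_form (u i) (u j) = 0"
        by (rule cases2[OF _ _ _ that(1)]; rule cases2[OF _ _ _ that(2)])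
          (use fv v(3) in \<open>auto simp: u\<close>)
      then show ?thesis using that by blast
    qed
    moreover have "0 \<le> kahler_form (u (2 * a)) (u (2 * a + 1))" if "2 * a + 1 < d" for a
      using that nonneg v(4) by (cases a) (auto simp: u)
    moreover have "kahler_form (u (2 * b)) (u (2 * b + 1)) \<le> kahler_form (u (2 * a)) (u (2 * a + 1))"
      if "a \<le> b" "2 * b + 1 < d" for a b
    proof (cases b)
      case (Suc b')
      show ?thesis
      proof (cases a)
        case 0
        then show ?thesis
          using Suc that max vW by (simp add: u)
      next
        case (Suc a')
        then show ?thesis
          using \<open>b = Suc b'\<close> that v(5)[of a' b'] by (simp add: u)
      qed
    qed (use that in simp)
    ultimately have "canonical_sequence d W u"
      unfolding canonical_sequence_def by (intro conjI allI impI)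
    then show ?thesis by (intro exI[of _ u])
  qed
qed

text \<open>The values on pairs are nonnegative and at most 1 by Cauchy-Schwarz;
  \<open>arccos\<close> turns their decreasing order into a sorted list of angles.\<close>

lemma exists_canonical_basis:
  fixes W :: "(complex, 'n::{finite,linorder}) vec set"
  assumes W: "W \<in> Gr CARD('n)"
  obtains w :: "'n \<Rightarrow> (complex, 'n) vec" and \<theta> where
    "orthonormal_basis_of W w" "canonical_basis \<theta> w" "angle_list (CARD('n) div 2) \<theta>"
proof -
  let ?n = "CARD('n)"
  have sub: "subspace W" and dim: "dim W = ?n"
    using W by (auto simp: Gr_def)
  obtain v :: "nat \<Rightarrow> (complex, 'n) vec" where "canonical_sequence ?n W v"
    using exists_canonical_sequence[OF sub dim] by blast
  note v = canonical_sequenceD[OF this]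
  define c where "c a = kahler_form (v (2 * a)) (v (2 * a + 1))" for a
  define w where "w j = v (rk j)" for j :: 'n
  define \<theta> where "\<theta> = map (\<lambda>a. arccos (c a)) [0..<?n div 2]"
  have c: "0 \<le> c a" "c a \<le> 1" if "a < ?n div 2" for a
  proof -
    have a: "2 * a < ?n" "2 * a + 1 < ?n" using that by auto
    then show "0 \<le> c a" using v(4) by (simp add: c_def)
    have "norm (v (2 * a)) = 1" "norm (v (2 * a + 1)) = 1"
      using v(2)[OF a(1) a(1)] v(2)[OF a(2) a(2)] by (simp_all add: norm_eq_sqrt_inner)
    then show "c a \<le> 1"
      using kahler_form_le[of "v (2 * a)" "v (2 * a + 1)"] by (simp add: c_def)
  qed
  have w: "w j \<bullet> w k = (if j = k then 1 else 0)" for j k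
    using v(2) rk_less[of j] rk_less[of k] by (simp add: w_def)
  have "span (range w) = W"
  proof (rule subspace_dim_equal[symmetric, symmetric])
    show "span (range w) \<subseteq> W"
      using v(1) rk_less sub by (intro span_minimal) (auto simp: w_def)
    show "dim W \<le> dim (span (range w))"
      using orthonormal_basis_of_imp_Gr[OF orthonormal_basis_of_span[OF w]] dim
      by (simp add: Gr_def)
  qed (use sub in auto)
  then have "orthonormal_basis_of W w"
    using w by (simp add: orthonormal_basis_of_def)
  moreover have "canonical_basis \<theta> w"
  proof -
    have "kahler_form (w j) (w k) = (if k = mate j then kcoeff \<theta> j else 0)" for j k
    proof (cases "rk j div 2 = rk k div 2")
      case False
      then have "k \<noteq> mate j"
        using rk_mate_div_2[of j] by metis
      then show ?thesis
        using v(3)[OF rk_less rk_less False] by (simp add: w_def)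
    next
      case True
      show ?thesis
      proof (cases "k = j")
        case True
        then show ?thesis by (auto simp: kcoeff_def)
      next
        case False
        define a where "a = rk j div 2"
        have "rk j \<noteq> rk k" using False by simp
        then have jk: "rk j = 2 * a \<and> rk k = 2 * a + 1 \<or> rk j = 2 * a + 1 \<and> rk k = 2 * a"
          using True unfolding a_def by presburger
        have a: "a < ?n div 2"
          using jk rk_less[of j] rk_less[of k] by auto
        have "\<theta> ! a = arccos (c a)"
          using a by (simp add: \<theta>_def)
        then have cos: "cos (\<theta> ! a) = c a"
          using c[OF a] by (simp add: cos_arccos)
        have mate: "k = mate j"
          by (subst rk_eq_iff[symmetric]) (use jk rk_less[of k] in \<open>auto simp: rk_mate\<close>)
        show ?thesis
          using jk False mate cos kahler_form_commute[of "v (2 * a)" "v (2 * a + 1)"]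
          by (auto simp: w_def kcoeff_def c_def)
      qed
    qed
    then show ?thesis
      using w by (simp add: canonical_basis_def)
  qed
  moreover have "angle_list (?n div 2) \<theta>"
  proof -
    have "arccos (c a) \<le> arccos (c b)" if "a \<le> b" "b < ?n div 2" for a b
      using v(5)[of a b] c[of a] c[of b] that by (intro arccos_le_arccos) (auto simp: c_def)
    moreover have "arccos (c a) \<in> {0..pi/2}" if "a < ?n div 2" for a
      using arccos_lbound[of "c a"] arccos_le_pi2[of "c a"] c[OF that] by simp
    ultimately show ?thesis
      by (auto simp: angle_list_def \<theta>_def sorted_iff_nth_mono)
  qed
  ultimately show ?thesis by (rule that)
qed


section \<open>The Theta invariant of a canonical basis\<close>

text \<open>A zero coefficient puts a basis vector into the kernel of the form; conversely, pairing
  with \<open>w (mate k)\<close> isolates coordinate \<open>k\<close>, scaled by its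
  coefficient.\<close>

lemma nondegenerate_iff_kcoeff:
  fixes w :: "'n::{finite,linorder} \<Rightarrow> (complex, 'n) vec"
  assumes w: "orthonormal_basis_of W w" and can: "canonical_basis \<theta> w"
  shows "nondegenerate_on W \<longleftrightarrow> (\<forall>j::'n. kcoeff \<theta> j \<noteq> 0)"
proof
  assume nd: "nondegenerate_on W"
  show "\<forall>j::'n. kcoeff \<theta> j \<noteq> 0"
  proof (intro allI notI)
    fix j :: 'n assume "kcoeff \<theta> j = 0"
    then have wk: "kahler_form (w j) (w k) = 0" for k
      using can by (simp add: canonical_basis_def)
    have "kahler_form (w j) y = 0" if "y \<in> W" for y
      by (subst orthonormal_expansion[OF w that, symmetric]) (simp add: kahler_form_sum_right wk)
    then have "w j = 0"
      using nd orthonormal_basis_of_in[OF w] unfolding nondegenerate_on_def by blast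
    moreover have "w j \<bullet> w j = 1"
      using can by (simp add: canonical_basis_def)
    ultimately show False by simp
  qed
next
  assume nz: "\<forall>j::'n. kcoeff \<theta> j \<noteq> 0"
  show "nondegenerate_on W"
    unfolding nondegenerate_on_def
  proof (intro ballI impI)
    fix x assume x: "x \<in> W" and 0: "\<forall>y\<in>W. kahler_form x y = 0"
    have "x \<bullet> w k = 0" for k
    proof -
      have "kahler_form x (w (mate k)) = (\<Sum>l\<in>UNIV. (x \<bullet> w l) * kahler_form (w l) (w (mate k)))"
        by (subst orthonormal_expansion[OF w x, symmetric]) (simp add: kahler_form_sum_left)
      also have "\<dots> = (\<Sum>l\<in>UNIV. if l = k then (x \<bullet> w l) * kcoeff \<theta> l else 0)"
      proof (rule sum.cong)
        fix l :: 'n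
        show "(x \<bullet> w l) * kahler_form (w l) (w (mate k)) =
            (if l = k then (x \<bullet> w l) * kcoeff \<theta> l else 0)"
          using can by (simp add: canonical_basis_def mate_eq_mate_iff)
      qed simp
      also have "\<dots> = (x \<bullet> w k) * kcoeff \<theta> k"
        by simp
      finally show ?thesis
        using 0 nz orthonormal_basis_of_in[OF w, of "mate k"] by simp
    qed
    then show "x = 0"
      using orthonormal_expansion[OF w x] by simp
  qed
qed

text \<open>Links nondegeneracy to the condition in the theorem: the largest angle controls all
  cosines, and an unpaired index always has coefficient 0. The bound on the dimension makes the list
  nonempty, so that \<open>last\<close> is meaningful.\<close>

lemma kcoeff_nonzero_iff:
  assumes n2: "CARD('n::{finite,linorder}) \<ge> 2" and \<theta>: "angle_list (CARD('n) div 2) \<theta>"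
  shows "(\<forall>j::'n. kcoeff \<theta> j \<noteq> 0) \<longleftrightarrow> even CARD('n) \<and> last \<theta> < pi/2"
proof -
  let ?m = "CARD('n) div 2"
  have len: "length \<theta> = ?m" and "\<theta> \<noteq> []"
    using \<theta> n2 by (auto simp: angle_list_def)
  then have last: "last \<theta> = \<theta> ! (?m - 1)"
    by (simp add: last_conv_nth)
  let ?j = "en (CARD('n) - 1) :: 'n"
  have rj: "rk ?j = CARD('n) - 1" using n2 by simp
  show ?thesis
  proof
    assume nz: "\<forall>j::'n. kcoeff \<theta> j \<noteq> 0"
    then have mj: "mate ?j \<noteq> ?j" by (metis kcoeff_def)
    then have even: "even CARD('n)"
      using n2 rj by (auto simp: mate_fixed_iff)
    then have "(CARD('n) - 1) div 2 = ?m - 1"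
      using n2 by presburger
    then have "angle_at \<theta> ?j = last \<theta>"
      unfolding last rj by simp
    then have "cos (last \<theta>) \<noteq> 0" "last \<theta> \<le> pi/2"
      using nz[rule_format, of ?j] mj angle_at_range[OF \<theta> mj]
      by (auto simp: kcoeff_def split: if_splits)
    then show "even CARD('n) \<and> last \<theta> < pi/2"
      using even by (metis cos_pi_half less_eq_real_def)
  next
    assume *: "even CARD('n) \<and> last \<theta> < pi/2"
    show "\<forall>j::'n. kcoeff \<theta> j \<noteq> 0"
    proof
      fix j :: 'n
      have mj: "mate j \<noteq> j"
        using * by (metis even_Suc mate_fixed_iff Suc_eq_plus1)
      have "rk j div 2 \<le> ?m - 1" "?m - 1 < length \<theta>"
        using len rk_less[of j] * n2 by (auto elim!: evenE)
      then have "angle_at \<theta> j \<le> last \<theta>"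
        using \<theta> unfolding last by (intro sorted_nth_mono) (auto simp: angle_list_def)
      then have "cos (angle_at \<theta> j) > 0"
        using angle_at_range[OF \<theta> mj] * by (intro cos_gt_zero_pi) auto
      then show "kcoeff \<theta> j \<noteq> 0"
        using mj by (simp add: kcoeff_def)
    qed
  qed
qed

lemma orthonormal_basis_of_sign_change:
  fixes w w' :: "'n \<Rightarrow> complex^'n"
  assumes w: "orthonormal_basis_of W w" and w': "\<And>j. w' j = w j \<or> w' j = - w j"
  shows "orthonormal_basis_of W w'"
proof -
  have ip: "w j \<bullet> w k = (if j = k then 1 else 0)" for j k
    using w by (simp add: orthonormal_basis_of_def)
  have "w' j \<bullet> w' k = (if j = k then 1 else 0)" for j k
    using w'[of j] w'[of k] ip[of j k] by (cases "j = k") auto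
  moreover have "span (range w') = span (range w)"
  proof (rule subset_antisym; rule span_minimal)
    have "w' j \<in> span (range w)" for j
      using w'[of j] by (metis rangeI span_base span_neg)
    then show "range w' \<subseteq> span (range w)" by auto
    have "w j \<in> span (range w')" for j
      using w'[of j] by (metis minus_minus rangeI span_base span_neg)
    then show "range w \<subseteq> span (range w')" by auto
  qed auto
  ultimately show ?thesis
    using w by (simp add: orthonormal_basis_of_def)
qed

lemma det_orthonormal_change:
  fixes v w :: "'n \<Rightarrow> complex^'n"
  assumes v: "orthonormal_basis_of W v" and w: "orthonormal_basis_of W w"
  shows "det (\<chi> i j. w j $ i) = of_real (det (\<chi> j k. w j \<bullet> v k)) * det (\<chi> i j. v j $ i)"
proof -
  let ?Q = "\<chi> j k. complex_of_real ((\<chi> j k. w j \<bullet> v k) $ j $ k)"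
  have "w j $ i = (\<Sum>k\<in>UNIV. v k $ i * of_real (w j \<bullet> v k))" for i j
    by (subst orthonormal_expansion[OF v orthonormal_basis_of_in[OF w], symmetric])
      (simp add: scaleR_conv_of_real[where 'a = complex] mult.commute)
  then have "(\<chi> i j. w j $ i) = (\<chi> i j. v j $ i) ** Finite_Cartesian_Product.transpose ?Q"
    by (simp add: vec_eq_iff matrix_matrix_mult_def Finite_Cartesian_Product.transpose_def)
  then have "det (\<chi> i j. w j $ i) = det (\<chi> i j. v j $ i) * det ?Q"
    by (simp add: det_mul)
  then show ?thesis
    unfolding det_of_real by simp
qed

text \<open>Another orthonormal basis multiplies the determinant by \<open>q v\<close>, which is 1
  or -1. In the nondegenerate case positive orientation means \<open>q v > 0\<close>, because the
  exterior power is positive on \<open>w\<close> and scales by \<open>q v\<close>.\<close>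

lemma Theta_canonical:
  fixes w :: "'n::{finite,linorder} \<Rightarrow> (complex, 'n) vec"
  assumes w: "orthonormal_basis_of W w" and can: "canonical_basis \<theta> w"
    and n2: "CARD('n) \<ge> 2" and \<theta>: "angle_list (CARD('n) div 2) \<theta>"
  shows "Theta W = theta_value (even CARD('n) \<and> last \<theta> < pi/2) (det (\<chi> i j. w j $ i))"
    (is "_ = theta_value _ ?z")
proof -
  define q where "q v = det (\<chi> j k. v j \<bullet> w k)" for v :: "'n \<Rightarrow> (complex, 'n) vec"
  have q: "det (\<chi> i j. v j $ i) = of_real (q v) * ?z" "q v = 1 \<or> q v = - 1"
    if "orthonormal_basis_of W v" for v
    using det_orthonormal_change[OF w that] orthonormal_basis_change(2)[OF w that]
      det_orthogonal_matrix unfolding q_def by blast+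
  have nd: "nondegenerate_on W \<longleftrightarrow> even CARD('n) \<and> last \<theta> < pi/2"
    using nondegenerate_iff_kcoeff[OF w can] kcoeff_nonzero_iff[OF n2 \<theta>] by simp
  show ?thesis
  proof (cases "even CARD('n) \<and> last \<theta> < pi/2")
    case True
    let ?m = "CARD('n) div 2"
    have n: "CARD('n) = 2 * ?m" using True by simp
    have cos: "cos (\<theta> ! k) > 0" if "k < ?m" for k
    proof -
      have k: "k < length \<theta>" using that \<theta> by (simp add: angle_list_def)
      then have "last \<theta> = \<theta> ! (length \<theta> - 1)"
        by (intro last_conv_nth) auto
      then have "\<theta> ! k \<le> last \<theta>"
        using \<theta> k sorted_nth_mono[of \<theta> k "length \<theta> - 1"] by (simp add: angle_list_def)
      moreover have "0 \<le> \<theta> ! k"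
        using \<theta> nth_mem[OF k] by (auto simp: angle_list_def)
      ultimately show ?thesis
        using True by (intro cos_gt_zero_pi) auto
    qed
    have wpos: "kahler_form_power ?m (\<lambda>k. w (en k)) > 0"
      by (rule kahler_form_power_canonical_pos[OF n can cos])
    have po: "positively_oriented v \<longleftrightarrow> q v > 0" if v: "orthonormal_basis_of W v" for v
    proof -
      have "(\<lambda>k. v (en k)) = (\<lambda>k. \<Sum>l\<in>UNIV. (\<chi> j k. v j \<bullet> w k) $ en k $ l *\<^sub>R w l)"
        using orthonormal_basis_change(1)[OF w v] by auto
      then have "kahler_form_power ?m (\<lambda>k. v (en k)) = q v * kahler_form_power ?m (\<lambda>k. w (en k))"
        using kahler_form_power_change[OF n, of "\<chi> j k. v j \<bullet> w k" w] by (simp add: q_def)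
      then show ?thesis
        using wpos by (simp add: positively_oriented_def zero_less_mult_iff flip: en_def)
    qed
    have "q w = 1"
    proof -
      have "(\<chi> j k. w j \<bullet> w k) = (mat 1 :: ((real, 'n) vec, 'n) vec)"
        using w by (simp add: vec_eq_iff mat_def orthonormal_basis_of_def)
      then show ?thesis by (simp add: q_def)
    qed
    have "Theta W = {?z}"
    proof (rule subset_antisym; rule subsetI)
      fix x assume "x \<in> Theta W"
      then obtain v where v: "orthonormal_basis_of W v" "positively_oriented v"
        and x: "x = det (\<chi> i j. v j $ i)"
        unfolding Theta_def using nd True by blast
      then have "q v = 1"
        using po q(2) by fastforce
      then show "x \<in> {?z}"
        using q(1)[OF v(1)] x by simp
    next
      fix x assume "x \<in> {?z}"
      then show "x \<in> Theta W"
        using w po[OF w] \<open>q w = 1\<close> unfolding Theta_def by auto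
    qed
    then show ?thesis
      using True by (simp add: theta_value_def)
  next
    case False
    have "Theta W = {?z, - ?z}"
    proof (rule subset_antisym; rule subsetI)
      fix x assume "x \<in> Theta W"
      then show "x \<in> {?z, - ?z}"
        unfolding Theta_def using q by fastforce
    next
      \<comment> \<open>Negating one vector, at an arbitrary index, realizes the opposite
        determinant.\<close>
      define w' where "w' = w(undefined := - w undefined)"
      have "orthonormal_basis_of W w'"
        by (rule orthonormal_basis_of_sign_change[OF w]) (simp add: w'_def)
      moreover have "det (\<chi> i j. w' j $ i) = - ?z"
      proof -
        have "column k (\<chi> i j. w' j $ i) = column k ((\<chi> i j. w j $ i) ** phase_at undefined (- 1))" for k
          unfolding column_phase_at by (simp add: column_def w'_def vec_eq_iff)
        then have "(\<chi> i j. w' j $ i) = (\<chi> i j. w j $ i) ** phase_at undefined (- 1)"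
          by (simp add: vec_eq_iff column_def)
        then show ?thesis
          by (simp add: det_mul det_phase_at)
      qed
      moreover fix x assume "x \<in> {?z, - ?z}"
      ultimately show "x \<in> Theta W"
        using w nd False unfolding Theta_def by (metis (mono_tags, lifting) insertE mem_Collect_eq singletonD)
    qed
    then show ?thesis
      unfolding theta_value_def if_not_P[OF False] .
  qed
qed


section \<open>Subspaces spanned by frames\<close>

abbreviation frame_span ::
  "((complex, 'n::{finite,linorder}) vec, 'n) vec \<Rightarrow> real list \<Rightarrow> (complex, 'n) vec set" where
  "frame_span F \<theta> \<equiv> span (range (frame F \<theta>))"

abbreviation sin_prod :: "real list \<Rightarrow> real" where
  "sin_prod \<theta> \<equiv> \<Prod>j<length \<theta>. sin (\<theta> ! j)"

lemma sin_prod_nonneg: "angle_list m \<theta> \<Longrightarrow> 0 \<le> sin_prod \<theta>"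
  by (intro prod_nonneg ballI sin_ge_zero) (auto simp: angle_list_def dest!: nth_mem subsetD)

lemma orthonormal_basis_of_frame_span:
  "F \<in> unitary_group \<Longrightarrow> orthonormal_basis_of (frame_span F \<theta>) (frame F \<theta>)"
  using canonical_basis_frame[of F \<theta>]
  by (intro orthonormal_basis_of_span) (simp add: canonical_basis_def)

lemma frame_span_invariants:
  fixes F :: "((complex, 'n::{finite,linorder}) vec, 'n) vec"
  assumes F: "F \<in> unitary_group" and \<theta>: "angle_list (CARD('n) div 2) \<theta>"
  shows "frame_span F \<theta> \<in> Gr CARD('n)" "kahler_angles (frame_span F \<theta>) = \<theta>"
    "CARD('n) \<ge> 2 \<Longrightarrow> nondegenerate_on (frame_span F \<theta>) \<longleftrightarrow> even CARD('n) \<and> last \<theta> < pi/2"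
    "CARD('n) \<ge> 2 \<Longrightarrow> Theta (frame_span F \<theta>) =
       theta_value (even CARD('n) \<and> last \<theta> < pi/2) (det F * of_real (sin_prod \<theta>))"
proof -
  note w = orthonormal_basis_of_frame_span[OF F, of \<theta>] and can = canonical_basis_frame[OF F, of \<theta>]
  have len: "length \<theta> = CARD('n) div 2"
    using \<theta> by (simp add: angle_list_def)
  show "frame_span F \<theta> \<in> Gr CARD('n)"
    by (rule orthonormal_basis_of_imp_Gr[OF w])
  show "kahler_angles (frame_span F \<theta>) = \<theta>"
    by (rule kahler_angles_canonical[OF w can \<theta>])
  show "nondegenerate_on (frame_span F \<theta>) \<longleftrightarrow> even CARD('n) \<and> last \<theta> < pi/2" if "CARD('n) \<ge> 2"
    using nondegenerate_iff_kcoeff[OF w can] kcoeff_nonzero_iff[OF that \<theta>] by simp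
  show "Theta (frame_span F \<theta>) =
       theta_value (even CARD('n) \<and> last \<theta> < pi/2) (det F * of_real (sin_prod \<theta>))"
    if "CARD('n) \<ge> 2"
    using Theta_canonical[OF w can that \<theta>] by (simp add: det_frame len)
qed

lemma Gr_obtain_frame:
  fixes W :: "(complex, 'n::{finite,linorder}) vec set"
  assumes "W \<in> Gr CARD('n)"
  obtains F \<theta> where "F \<in> unitary_group" "angle_list (CARD('n) div 2) \<theta>" "W = frame_span F \<theta>"
proof -
  obtain w :: "'n \<Rightarrow> (complex, 'n) vec" and \<theta> where w: "orthonormal_basis_of W w"
    "canonical_basis \<theta> w" "angle_list (CARD('n) div 2) \<theta>"
    using exists_canonical_basis[OF assms] by blast
  obtain F where "F \<in> unitary_group" "w = frame F \<theta>"
    using canonical_basis_imp_frame[OF w(2,3)] by blast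
  then show ?thesis
    using that w by (auto simp: orthonormal_basis_of_def)
qed

lemma image_frame_span: "(\<lambda>x. g *v x) ` frame_span F \<theta> = frame_span (g ** F) \<theta>"
  by (simp add: linear_span_image[OF linear_matrix_vector, symmetric] image_image frame_mult)

(* Theta only determines the determinant of the frame up to the phase of a column that does not
   matter (if some angle is 0) or up to the sign of the last column. *)
lemma frame_with_same_det:
  fixes F1 F2 :: "((complex, 'n::{finite,linorder}) vec, 'n) vec"
  assumes F1: "F1 \<in> unitary_group" and F2: "F2 \<in> unitary_group"
    and n2: "CARD('n) \<ge> 2" and \<theta>: "angle_list (CARD('n) div 2) \<theta>"
    and eq: "theta_value (even CARD('n) \<and> last \<theta> < pi/2) (det F1 * of_real (sin_prod \<theta>)) =
             theta_value (even CARD('n) \<and> last \<theta> < pi/2) (det F2 * of_real (sin_prod \<theta>))"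
  obtains F where "F \<in> unitary_group" "det F = det F1" "frame_span F \<theta> = frame_span F2 \<theta>"
proof -
  have len: "length \<theta> = CARD('n) div 2" and ne: "\<theta> \<noteq> []"
    using \<theta> n2 by (auto simp: angle_list_def)
  have even_mate: "even (rk (mate j))" if "odd (rk j)" for j :: 'n
    using that by (simp add: rk_mate)
  show ?thesis
  proof (cases "sin_prod \<theta> = 0")
    case True
    then obtain a where a: "a < CARD('n) div 2" "sin (\<theta> ! a) = 0"
      using len by auto
    \<comment> \<open>The second member of a pair with vanishing sine: its column enters the frame
      only with coefficient 0, so it can absorb any phase.\<close>
    let ?k = "en (2 * a + 1) :: 'n" and ?c = "det F1 / det F2"
    have rk: "rk ?k = 2 * a + 1" using a by simp
    have c: "cmod ?c = 1"
      using cmod_det_unitary[OF F1] cmod_det_unitary[OF F2] by (simp add: norm_divide)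
    have "frame (F2 ** phase_at ?k ?c) \<theta> j = frame F2 \<theta> j" for j
    proof -
      have "mate j \<noteq> ?k" if "odd (rk j)"
        using even_mate[OF that] rk by auto
      moreover have "j \<noteq> ?k" if "even (rk j)"
        using that rk by auto
      moreover have "sin (angle_at \<theta> j) = 0" if "j = ?k"
        using that rk a by simp
      ultimately show ?thesis
        by (auto simp: frame_def column_phase_at)
    qed
    then have "frame (F2 ** phase_at ?k ?c) \<theta> = frame F2 \<theta>"
      by auto
    moreover have "det (F2 ** phase_at ?k ?c) = det F1"
      using cmod_det_unitary[OF F2] by (auto simp: det_mul det_phase_at)
    ultimately show ?thesis
      using that[of "F2 ** phase_at ?k ?c"] F2 unitary_phase_at[OF c] unitary_mult by metis
  next
    case s: False
    show ?thesis
    proof (cases "det F1 = det F2")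
      case True
      then show ?thesis using that[of F2] F2 by simp
    next
      case False
      have deg: "\<not> (even CARD('n) \<and> last \<theta> < pi/2)"
      proof
        assume "even CARD('n) \<and> last \<theta> < pi/2"
        then have "det F1 * of_real (sin_prod \<theta>) = det F2 * of_real (sin_prod \<theta>)"
          using eq by (simp add: theta_value_def)
        then show False
          using s False by simp
      qed
      then have "{det F1 * of_real (sin_prod \<theta>), - (det F1 * of_real (sin_prod \<theta>))} =
          {det F2 * of_real (sin_prod \<theta>), - (det F2 * of_real (sin_prod \<theta>))}"
        using eq by (simp only: theta_value_def if_False)
      then have "det F1 * of_real (sin_prod \<theta>) = - det F2 * of_real (sin_prod \<theta>)"
        using s False by (auto simp: doubleton_eq_iff)
      then have d: "det F1 = - det F2"
        using s by (metis mult_cancel_right of_real_eq_0_iff)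
      \<comment> \<open>The last index is unpaired for odd dimension, and has angle
        \<open>pi/2\<close> for even dimension by degeneracy. Its column thus occurs in one frame
        vector only, and negating it negates just that vector.\<close>
      let ?k = "en (CARD('n) - 1) :: 'n"
      let ?F = "F2 ** phase_at ?k (- 1)"
      have rk: "rk ?k = CARD('n) - 1" using n2 by simp
      have "frame ?F \<theta> j = frame F2 \<theta> j \<or> frame ?F \<theta> j = - frame F2 \<theta> j" for j
      proof (cases "odd (rk j)")
        case True
        have mj: "mate j \<noteq> ?k"
        proof
          assume k: "mate j = ?k"
          then have "even (rk ?k)" using even_mate[OF True] by simp
          then have "mate ?k = ?k"
            using rk n2 by (simp add: mate_fixed_iff)
          then show False
            using k True \<open>even (rk ?k)\<close> by (metis mate_mate)
        qed
        show ?thesis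
        proof (cases "j = ?k")
          case jk: True
          then have even: "even CARD('n)"
            using True rk n2 by auto
          then have "rk j div 2 = CARD('n) div 2 - 1"
            unfolding jk rk using n2 by (auto elim!: evenE)
          then have "angle_at \<theta> j = last \<theta>"
            by (simp add: last_conv_nth ne len)
          moreover have "last \<theta> = pi/2"
            using deg even \<theta> last_in_set[OF ne] by (force simp: angle_list_def)
          ultimately have "cos (angle_at \<theta> j) = 0"
            by (simp only: cos_pi_half)
          then show ?thesis
            using True jk mj by (simp add: frame_def column_phase_at vec_eq_iff)
        next
          case False
          then show ?thesis
            using True mj by (simp add: frame_def column_phase_at)
        qed
      next
        case False
        then show ?thesis
          by (simp add: frame_def column_phase_at vec_eq_iff)
      qed
      then have "orthonormal_basis_of (frame_span F2 \<theta>) (frame ?F \<theta>)"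
        by (rule orthonormal_basis_of_sign_change[OF orthonormal_basis_of_frame_span[OF F2]])
      moreover have "?F \<in> unitary_group"
        by (intro unitary_mult F2 unitary_phase_at) simp
      moreover have "det ?F = det F1"
        using d by (simp add: det_mul det_phase_at)
      ultimately show ?thesis
        using that by (simp add: orthonormal_basis_of_def)
    qed
  qed
qed

text \<open>Left multiplication by \<open>g\<close> of determinant 1 keeps the determinant of the
  matrix. Conversely, once \<open>F2\<close> is replaced by a matrix \<open>F\<close> with the
  determinant of \<open>F1\<close> and the same frame span, \<open>F ** adj F1\<close> is the
  required map.\<close>

lemma SU_orbit_iff:
  fixes W1 W2 :: "(complex, 'n::{finite,linorder}) vec set"
  assumes n2: "CARD('n) \<ge> 2" and W1: "W1 \<in> Gr CARD('n)" and W2: "W2 \<in> Gr CARD('n)"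
  shows "(\<exists>g\<in>special_unitary_group. (\<lambda>x. g *v x) ` W1 = W2) \<longleftrightarrow>
    kahler_angles W1 = kahler_angles W2 \<and> Theta W1 = Theta W2"
proof -
  obtain F1 \<theta> where F1: "F1 \<in> unitary_group" and \<theta>: "angle_list (CARD('n) div 2) \<theta>"
    and W1_eq: "W1 = frame_span F1 \<theta>"
    using Gr_obtain_frame[OF W1] by blast
  note inv1 = frame_span_invariants[OF F1 \<theta>]
  show ?thesis
  proof
    assume "\<exists>g\<in>special_unitary_group. (\<lambda>x. g *v x) ` W1 = W2"
    then obtain g where g: "g \<in> unitary_group" "det g = 1" and W2_eq: "W2 = frame_span (g ** F1) \<theta>"
      unfolding W1_eq image_frame_span special_unitary_group_def by blast
    show "kahler_angles W1 = kahler_angles W2 \<and> Theta W1 = Theta W2"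
      unfolding W1_eq W2_eq
      using inv1 frame_span_invariants[OF unitary_mult[OF g(1) F1] \<theta>] n2 g by (simp add: det_mul)
  next
    assume eq: "kahler_angles W1 = kahler_angles W2 \<and> Theta W1 = Theta W2"
    obtain F2 \<eta> where F2: "F2 \<in> unitary_group" and \<eta>: "angle_list (CARD('n) div 2) \<eta>"
      and W2_eq: "W2 = frame_span F2 \<eta>"
      using Gr_obtain_frame[OF W2] by blast
    note inv2 = frame_span_invariants[OF F2 \<eta>]
    have "\<eta> = \<theta>"
      using eq inv1(2) inv2(2) by (simp add: W1_eq W2_eq)
    then have "theta_value (even CARD('n) \<and> last \<theta> < pi/2) (det F1 * of_real (sin_prod \<theta>)) =
             theta_value (even CARD('n) \<and> last \<theta> < pi/2) (det F2 * of_real (sin_prod \<theta>))"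
      using eq inv1(4) inv2(4) n2 by (simp only: W1_eq W2_eq)
    then obtain F where F: "F \<in> unitary_group" "det F = det F1" "frame_span F \<theta> = frame_span F2 \<theta>"
      using frame_with_same_det[OF F1 F2 n2 \<theta>] by blast
    let ?g = "F ** adj F1"
    have "?g \<in> unitary_group"
      using F F1 by (intro unitary_mult unitary_adj)
    moreover have "det ?g = 1"
    proof -
      have "det (F1 ** adj F1) = 1"
        using F1 by (simp add: unitary_right)
      then show ?thesis
        using F(2) by (simp add: det_mul)
    qed
    moreover have "?g ** F1 = F"
      using F1 by (simp add: unitary_iff flip: matrix_mul_assoc)
    then have "(\<lambda>x. ?g *v x) ` W1 = W2"
      unfolding W1_eq image_frame_span by (simp add: W2_eq F(3) \<open>\<eta> = \<theta>\<close>)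
    ultimately show "\<exists>g\<in>special_unitary_group. (\<lambda>x. g *v x) ` W1 = W2"
      unfolding special_unitary_group_def by blast
  qed
qed


section \<open>Orthogonal complements\<close>

(* Complementing exchanges the two columns of each pair of a frame and multiplies all
   columns by i. *)
definition mate_frame ::
  "((complex, 'n::{finite,linorder}) vec, 'n) vec \<Rightarrow> ((complex, 'n) vec, 'n) vec" where
  "mate_frame F = (\<chi> i j. \<i> * F $ i $ mate j)"

lemma column_mate_frame: "column j (mate_frame F) = \<i> *s column (mate j) F"
  by (simp add: column_def mate_frame_def vec_eq_iff)

lemma unitary_mate_frame:
  assumes "F \<in> unitary_group"
  shows "mate_frame F \<in> unitary_group"
  using assms
  by (simp add: unitary_iff_columns column_mate_frame hprod_smult_left hprod_smult_right
      mate_eq_mate_iff)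

text \<open>The n factors i from the columns and the sign of the pairing cancel for even dimension
  and leave one factor i for odd dimension, whence the two cases for complements.\<close>

lemma det_mate_frame:
  fixes F :: "((complex, 'n::{finite,linorder}) vec, 'n) vec"
  shows "det (mate_frame F) = (if even CARD('n) then det F else \<i> * det F)"
proof -
  have "mate_frame F = mat \<i> ** (\<chi> i j. F $ i $ mate j)"
    by (simp add: mate_frame_def vec_eq_iff matrix_matrix_mult_def mat_def if_distrib if_distribR
        cong: if_cong)
  moreover have "det (mat \<i> :: ((complex, 'n) vec, 'n) vec) = \<i> ^ CARD('n)"
    by (subst det_diagonal) (auto simp: mat_def)
  ultimately have "det (mate_frame F) = \<i> ^ CARD('n) * (- 1) ^ (CARD('n) div 2) * det F"
    by (simp add: det_mul det_permute_columns[OF permutes_mate] sign_mate)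
  moreover have "\<i> ^ CARD('n) * (- 1) ^ (CARD('n) div 2) = (if even CARD('n) then 1 else \<i>)"
  proof -
    have "\<i> ^ (2 * m) * (- 1) ^ m = 1" for m
      by (simp add: power_mult flip: power_mult_distrib)
    then show ?thesis
      by (cases "even CARD('n)") (auto elim!: evenE oddE)
  qed
  ultimately show ?thesis by simp
qed

text \<open>All Hermitian products between the two frames vanish or are purely imaginary, so the
  frames are orthogonal over the reals; both spans have real dimension n inside dimension
  2n.\<close>

lemma frame_span_complement:
  fixes F :: "((complex, 'n::{finite,linorder}) vec, 'n) vec"
  assumes F: "F \<in> unitary_group" and \<theta>: "angle_list (CARD('n) div 2) \<theta>"
  shows "(frame_span F \<theta>)\<^sup>\<bottom> = frame_span (mate_frame F) \<theta>"
proof (rule subspace_dim_equal[symmetric])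
  have col: "hprod (column j F) (column k F) = (if j = k then 1 else 0)" for j k
    using F by (simp add: unitary_iff_columns)
  have odd_mate: "mate j \<noteq> j" "even (rk (mate j))" if "odd (rk j)" for j :: 'n
    using that by (auto simp: mate_neq_if_odd even_rk_mate)
  have orth: "frame F \<theta> k \<bullet> frame (mate_frame F) \<theta> j = 0" for j k
  proof -
    have "Re (hprod (frame F \<theta> k) (frame (mate_frame F) \<theta> j)) = 0"
    proof (cases "odd (rk j)"; cases "odd (rk k)")
      assume "odd (rk j)" "odd (rk k)"
      then show ?thesis
        using odd_mate[of j] odd_mate[of k]
        by (auto simp: frame_def hprod_add_left hprod_add_right hprod_smult_left hprod_smult_right
            col column_mate_frame mate_eq_iff)
    next
      assume "odd (rk j)" "\<not> odd (rk k)"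
      then show ?thesis
        by (auto simp: frame_def hprod_add_right hprod_smult_right col column_mate_frame)
    next
      assume "\<not> odd (rk j)" "odd (rk k)"
      then show ?thesis
        by (auto simp: frame_def hprod_add_left hprod_smult_left hprod_smult_right col
            column_mate_frame mate_eq_mate_iff)
    next
      assume "\<not> odd (rk j)" "\<not> odd (rk k)"
      then show ?thesis
        by (simp add: frame_def hprod_smult_right col column_mate_frame)
    qed
    then show ?thesis by (simp add: hprod_eq_Complex)
  qed
  show "frame_span (mate_frame F) \<theta> \<subseteq> (frame_span F \<theta>)\<^sup>\<bottom>"
  proof (rule span_minimal[OF _ subspace_orthogonal_comp]; rule subsetI)
    fix x assume "x \<in> range (frame (mate_frame F) \<theta>)"
    then obtain j where x: "x = frame (mate_frame F) \<theta> j" by auto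
    have "orthogonal x y" if "y \<in> frame_span F \<theta>" for y
      by (rule orthogonal_to_span[OF that]) (auto simp: x orthogonal_def orth inner_commute)
    then show "x \<in> (frame_span F \<theta>)\<^sup>\<bottom>"
      by (auto simp: orthogonal_comp_def orthogonal_commute)
  qed
  have "dim (frame_span F \<theta>) = CARD('n)" "dim (frame_span (mate_frame F) \<theta>) = CARD('n)"
    using frame_span_invariants(1)[OF F \<theta>] frame_span_invariants(1)[OF unitary_mate_frame[OF F] \<theta>]
    by (simp_all add: Gr_def)
  moreover have "dim ((frame_span F \<theta>)\<^sup>\<bottom>) + dim (frame_span F \<theta>) = 2 * CARD('n)"
    using dim_subspace_orthogonal_to_vectors[of "frame_span F \<theta>" UNIV]
    by (simp add: orthogonal_comp_def)
  ultimately show "dim ((frame_span F \<theta>)\<^sup>\<bottom>) \<le> dim (frame_span (mate_frame F) \<theta>)"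
    by simp
qed (auto simp: subspace_orthogonal_comp)

lemma image_theta_value: "(\<lambda>x. c * x) ` theta_value b z = theta_value b (c * z)"
  by (simp add: theta_value_def)

lemma Theta_complement:
  fixes W :: "(complex, 'n::{finite,linorder}) vec set"
  assumes n2: "CARD('n) \<ge> 2" and W: "W \<in> Gr CARD('n)"
  shows "Theta (W\<^sup>\<bottom>) = (if even CARD('n) then Theta W else (\<lambda>z. \<i> * z) ` Theta W)"
proof -
  obtain F \<theta> where F: "F \<in> unitary_group" and \<theta>: "angle_list (CARD('n) div 2) \<theta>"
    and W_eq: "W = frame_span F \<theta>"
    using Gr_obtain_frame[OF W] by blast
  show ?thesis
    unfolding W_eq frame_span_complement[OF F \<theta>] frame_span_invariants(4)[OF F \<theta> n2]
      frame_span_invariants(4)[OF unitary_mate_frame[OF F] \<theta> n2] image_theta_value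
    by (simp add: det_mate_frame mult.assoc)
qed


section \<open>Unitary orbits outside the middle dimension\<close>

text \<open>A real basis of \<open>U\<close> imposes fewer than n complex conditions on a
  Hermitian-orthogonal vector \<open>x\<close>, and such an \<open>x\<close> is orthogonal to the
  complex span of \<open>U\<close> as well.\<close>

lemma exists_unitary_fixing:
  fixes U :: "(complex^'n) set"
  assumes U: "subspace U" "dim U < CARD('n)" and c: "cmod c = 1"
  obtains A :: "complex^'n^'n" where "A \<in> unitary_group" "det A = c" "\<And>y. y \<in> U \<Longrightarrow> A *v y = y"
proof -
  obtain B where B: "finite B" "card B = dim U" "span B = U"
    using orthonormal_basis_subspace[OF U(1)] by (metis independent_imp_finite)
  obtain S :: "'n set" where S: "card S = card B"
    using B U(2) ex_card[of "card B" "UNIV :: 'n set"] by auto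
  obtain f where f: "bij_betw f S B"
    using B(1) S finite_same_card_bij[of S B] by auto
  have "S \<noteq> UNIV"
    using S B U(2) by auto
  then obtain x where x: "norm x = 1" "\<And>j. j \<in> S \<Longrightarrow> hprod (f j) x = 0"
    using exists_hprod_orthogonal[of S f] by blast
  obtain A where A: "A \<in> unitary_group" "det A = c" "\<And>y. hprod x y = 0 \<Longrightarrow> A *v y = y"
    using unitary_fixing_orthogonal[OF x(1) c] by blast
  have "hprod x y = 0" if "y \<in> U" for y
  proof -
    have "y \<in> span B" using that B by simp
    then show ?thesis
    proof (induction rule: span_induct)
      case base
      then show ?case
        by (auto simp: subspace_def hprod_add_right hprod_scaleR_right)
    next
      case (step b)
      then obtain j where "j \<in> S" "b = f j"
        using f by (auto simp: bij_betw_def)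
      then show ?case
        using x(2) hprod_commute[of x b] by simp
    qed
  qed
  then show ?thesis
    using that A by blast
qed

text \<open>A unitary map preserves the real inner product, so one fixing the complement pointwise
  sends \<open>W\<close> into \<open>W\<close>; applying this to the adjoint as well gives
  equality.\<close>

lemma exists_unitary_preserving:
  fixes W :: "(complex^'n) set"
  assumes W: "W \<in> Gr k" and k: "k \<noteq> CARD('n)" and c: "cmod c = 1"
  obtains A :: "complex^'n^'n" where "A \<in> unitary_group" "det A = c" "(\<lambda>x. A *v x) ` W = W"
proof (cases "k < CARD('n)")
  case True
  then obtain A :: "complex^'n^'n" where A: "A \<in> unitary_group" "det A = c" "\<And>y. y \<in> W \<Longrightarrow> A *v y = y"
    using exists_unitary_fixing[of W c] W c by (auto simp: Gr_def)
  then have "(\<lambda>x. A *v x) ` W = W"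
    by simp
  then show ?thesis
    using that A by blast
next
  case False
  have sub: "subspace W" and dim: "dim W = k"
    using W by (auto simp: Gr_def)
  have "dim (W\<^sup>\<bottom>) + dim W = 2 * CARD('n)"
    using dim_subspace_orthogonal_to_vectors[of W UNIV] sub by (simp add: orthogonal_comp_def)
  then have "dim (W\<^sup>\<bottom>) < CARD('n)"
    using False dim k by simp
  then obtain A :: "complex^'n^'n" where A: "A \<in> unitary_group" "det A = c"
    "\<And>y. y \<in> W\<^sup>\<bottom> \<Longrightarrow> A *v y = y"
    using exists_unitary_fixing[OF subspace_orthogonal_comp _ c] by blast
  have into: "B *v w \<in> W" if B: "B \<in> unitary_group" "\<And>y. y \<in> W\<^sup>\<bottom> \<Longrightarrow> B *v y = y" and w: "w \<in> W"
    for B w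
  proof -
    have "orthogonal y (B *v w)" if "y \<in> W\<^sup>\<bottom>" for y
    proof -
      have "y \<bullet> (B *v w) = (B *v y) \<bullet> (B *v w)"
        using B(2)[OF that] by simp
      also have "\<dots> = y \<bullet> w"
        by (rule inner_unitary[OF B(1)])
      also have "\<dots> = 0"
        using that w by (auto simp: orthogonal_comp_def orthogonal_def inner_commute)
      finally show ?thesis by (simp add: orthogonal_def)
    qed
    then have "B *v w \<in> W\<^sup>\<bottom>\<^sup>\<bottom>"
      by (simp add: orthogonal_comp_def)
    then show ?thesis
      using orthogonal_comp_self[OF sub] by simp
  qed
  have "adj A *v y = y" if "y \<in> W\<^sup>\<bottom>" for y
    using A(3)[OF that] unitary_cancel(1)[OF A(1), of y] by simp
  then have "(\<lambda>x. A *v x) ` W = W"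
    using into[OF A(1,3)] into[OF unitary_adj[OF A(1)]] unitary_cancel(2)[OF A(1)]
    by (metis (no_types, lifting) image_iff image_subset_iff subsetI subset_antisym)
  then show ?thesis
    using that A by blast
qed

text \<open>A unitary \<open>U\<close> is corrected on the right by a map that preserves
  \<open>W\<close> and has the inverse determinant.\<close>

lemma subspace_orbit_eq:
  fixes W :: "(complex^'n) set"
  assumes W: "W \<in> Gr k" and k: "k \<noteq> CARD('n)"
  shows "subspace_orbit unitary_group W = subspace_orbit special_unitary_group W"
proof (rule subset_antisym; rule subsetI)
  fix V assume "V \<in> subspace_orbit unitary_group W"
  then obtain U where U: "U \<in> unitary_group" "V = (\<lambda>x. U *v x) ` W"
    by (auto simp: subspace_orbit_def)
  have "cmod (inverse (det U)) = 1"
    using cmod_det_unitary[OF U(1)] by (simp add: norm_inverse)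
  then obtain A where A: "A \<in> unitary_group" "det A = inverse (det U)" "(\<lambda>x. A *v x) ` W = W"
    using exists_unitary_preserving[OF W k] by blast
  have "V = (\<lambda>x. U *v x) ` (\<lambda>x. A *v x) ` W"
    using U A by simp
  then have "V = (\<lambda>x. (U ** A) *v x) ` W"
    by (simp add: image_image matrix_vector_mul_assoc)
  moreover have "det U \<noteq> 0"
    using cmod_det_unitary[OF U(1)] by auto
  then have "det (U ** A) = 1"
    using A by (simp add: det_mul)
  then have "U ** A \<in> special_unitary_group"
    using unitary_mult[OF U(1) A(1)] by (simp add: special_unitary_group_def)
  ultimately show "V \<in> subspace_orbit special_unitary_group W"
    by (auto simp: subspace_orbit_def)
qed (auto simp: subspace_orbit_def special_unitary_group_def)

section \<open>The modulus of Theta and the realization of prescribed invariants\<close>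

lemma cmod_Theta:
  fixes W :: "(complex, 'n::{finite,linorder}) vec set"
  assumes n2: "CARD('n) \<ge> 2" and W: "W \<in> Gr CARD('n)"
  shows "\<exists>z. Theta W = theta_value (nondegenerate_on W) z \<and>
    cmod z = (\<Prod>j<CARD('n) div 2. sin (kahler_angles W ! j))"
proof -
  obtain F \<theta> where F: "F \<in> unitary_group" and \<theta>: "angle_list (CARD('n) div 2) \<theta>"
    and W_eq: "W = frame_span F \<theta>"
    using Gr_obtain_frame[OF W] by blast
  note inv = frame_span_invariants[OF F \<theta>]
  have "cmod (det F * of_real (sin_prod \<theta>)) = sin_prod \<theta>"
    using cmod_det_unitary[OF F] sin_prod_nonneg[OF \<theta>]
    by (simp add: norm_mult del: of_real_prod)
  then show ?thesis
    unfolding W_eq inv(2) inv(3)[OF n2] inv(4)[OF n2] using \<theta> by (auto simp: angle_list_def)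
qed

lemma exists_subspace_with_invariants:
  fixes z :: complex
  assumes n2: "CARD('n::{finite,linorder}) \<ge> 2" and \<theta>: "angle_list (CARD('n) div 2) \<theta>"
    and z: "cmod z = sin_prod \<theta>"
  shows "\<exists>W\<in>(Gr CARD('n) :: (complex, 'n) vec set set). kahler_angles W = \<theta> \<and>
    Theta W = theta_value (even CARD('n) \<and> last \<theta> < pi/2) z"
proof -
  \<comment> \<open>\<open>c\<close> is the phase of \<open>z\<close>; if the product of sines is 0,
    then \<open>z\<close> is 0 and any phase will do.\<close>
  obtain c where c: "cmod c = 1" "z = c * of_real (sin_prod \<theta>)"
  proof (cases "sin_prod \<theta> = 0")
    case True
    then show ?thesis using z that[of 1] by (simp del: of_real_prod prod_zero_iff)
  next
    case False
    then have "cmod (z / of_real (sin_prod \<theta>)) = 1"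
      using z sin_prod_nonneg[OF \<theta>]
      by (simp add: norm_divide del: of_real_prod prod_zero_iff)
    then show ?thesis using that False by (simp del: of_real_prod prod_zero_iff)
  qed
  define F :: "((complex, 'n) vec, 'n) vec" where "F = phase_at undefined c"
  have F: "F \<in> unitary_group" "det F = c"
    using c by (simp_all add: F_def unitary_phase_at det_phase_at)
  show ?thesis
    using frame_span_invariants[OF F(1) \<theta>] n2 F(2) c by auto
qed

theorem proposition1p4:
  assumes n2: "CARD('n::{finite,linorder}) \<ge> 2"
  shows
    "(\<forall>W1 \<in> Gr CARD('n). \<forall>W2 \<in> Gr CARD('n).
        (\<exists>g \<in> (special_unitary_group :: ((complex, 'n) vec, 'n) vec set). (\<lambda>x. g *v x) ` W1 = W2) \<longleftrightarrow>
        kahler_angles W1 = kahler_angles W2 \<and> Theta W1 = Theta W2)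
     \<and>
     (\<forall>W \<in> (Gr CARD('n) :: (complex, 'n) vec set set).
        \<exists>z. Theta W = theta_value (nondegenerate_on W) z \<and>
            cmod z = (\<Prod>j<CARD('n) div 2. sin (kahler_angles W ! j)))
     \<and>
     (\<forall>(\<theta> :: real list) (z :: complex).
        length \<theta> = CARD('n) div 2 \<and> sorted \<theta> \<and> set \<theta> \<subseteq> {0..pi/2} \<and>
        cmod z = (\<Prod>j<CARD('n) div 2. sin (\<theta> ! j)) \<longrightarrow>
        (\<exists>W \<in> (Gr CARD('n) :: (complex, 'n) vec set set).
           kahler_angles W = \<theta> \<and>
           Theta W = theta_value (even CARD('n) \<and> last \<theta> < pi/2) z))
     \<and>
     (\<forall>W \<in> (Gr CARD('n) :: (complex, 'n) vec set set).
        Theta (W\<^sup>\<bottom>) = (if even CARD('n) then Theta W else (\<lambda>z. \<i> * z) ` Theta W))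
     \<and>
     (\<forall>k. k \<noteq> CARD('n) \<longrightarrow>
        (\<forall>W \<in> (Gr k :: (complex, 'n) vec set set).
           subspace_orbit unitary_group W = subspace_orbit special_unitary_group W))"
proof (intro conjI ballI allI impI)
  fix W1 W2 :: "(complex, 'n) vec set"
  assume "W1 \<in> Gr CARD('n)" "W2 \<in> Gr CARD('n)"
  then show "(\<exists>g\<in>special_unitary_group. (\<lambda>x. g *v x) ` W1 = W2) \<longleftrightarrow>
      kahler_angles W1 = kahler_angles W2 \<and> Theta W1 = Theta W2"
    by (rule SU_orbit_iff[OF n2])
next
  fix \<theta> :: "real list" and z :: complex
  assume "length \<theta> = CARD('n) div 2 \<and> sorted \<theta> \<and> set \<theta> \<subseteq> {0..pi/2} \<and>
    cmod z = (\<Prod>j<CARD('n) div 2. sin (\<theta> ! j))"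
  then show "\<exists>W\<in>(Gr CARD('n) :: (complex, 'n) vec set set). kahler_angles W = \<theta> \<and>
      Theta W = theta_value (even CARD('n) \<and> last \<theta> < pi/2) z"
    by (intro exists_subspace_with_invariants[OF n2]) (auto simp: angle_list_def)
next
  fix k and W :: "(complex, 'n) vec set"
  assume "k \<noteq> CARD('n)" "W \<in> Gr k"
  then show "subspace_orbit unitary_group W = subspace_orbit special_unitary_group W"
    by (intro subspace_orbit_eq)
qed (use cmod_Theta[OF n2] Theta_complement[OF n2] in auto)

end
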